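(* Let $S=\mathrm{PSL}_d(q)=\mathrm{PSL}(V)$ be simple, where $V$ is a $d$-dimensional vector space over the finite field $\mathbb{F}_q$. For $g\in S$, let $f(g)$ be the number of one-dimensional subspaces of $V$ fixed by $g$. If $A$ and $B$ are nontrivial conjugacy classes of $S$, then $f$ is not constant on $AB$ (in particular, $AB$ is not a conjugacy class).
   Context: $AB=\{xy\mid x\in A,\ y\in B\}$; a nontrivial conjugacy class is one different from $\{1\}$. *)

theory Defs
  imports "HOL-Analysis.Analysis" "HOL-Algebra.SimpleGroups" "HOL-Algebra.Group_Action"
begin

text \<open>
  The space \<open>V\<close> is \<open>'k ^ 'n\<close>, so \<open>q = CARD('k)\<close> and \<open>d = CARD('n)\<close>; matrices act on column vectors.
\<close>

definition SL :: "('k::{field,finite} ^ 'n::finite ^ 'n) monoid" where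
  "SL = \<lparr>carrier = {M. det M = 1}, monoid.mult = (**), one = mat 1\<rparr>"

definition SZ :: "('k::{field,finite} ^ 'n::finite ^ 'n) set" where
  "SZ = carrier SL \<inter> range mat"

definition PSL :: "('k::{field,finite} ^ 'n::finite ^ 'n) set monoid" where
  "PSL = SL Mod SZ"

definition lines :: "('k::{field,finite} ^ 'n::finite) set set" where
  "lines = {W. vec.subspace W \<and> vec.dim W = 1}"

text \<open>
  An element \<open>g\<close> of \<open>PSL\<close> is a coset of \<open>SZ\<close>. All of its members have the same effect on a
  subspace, so the union below is the image of \<open>W\<close> under any one of them.
\<close>

definition PSL_act ::
  "('k::{field,finite} ^ 'n::finite ^ 'n) set \<Rightarrow> ('k ^ 'n) set \<Rightarrow> ('k ^ 'n) set" where
  "PSL_act g W = (\<Union>M\<in>g. (*v) M ` W)"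

definition num_fixed_lines :: "('k::{field,finite} ^ 'n::finite ^ 'n) set \<Rightarrow> nat" where
  "num_fixed_lines g = card (invariants lines PSL_act g)"

definition conj_classes :: "('a, 'b) monoid_scheme \<Rightarrow> 'a set set" where
  "conj_classes G =
    orbits G (carrier G) (\<lambda>g. \<lambda>h \<in> carrier G. g \<otimes>\<^bsub>G\<^esub> h \<otimes>\<^bsub>G\<^esub> inv\<^bsub>G\<^esub> g)"

lemma group_SL: "group (SL :: ('k::{field,finite} ^ 'n::finite ^ 'n) monoid)"
proof (rule groupI)
  fix M :: "'k ^ 'n ^ 'n"
  assume M: "M \<in> carrier SL"
  then have "invertible M"
    by (simp add: SL_def invertible_det_nz)
  then obtain N where N: "N ** M = mat 1"
    by (auto simp: invertible_def)
  moreover have "det N = 1"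
    using arg_cong[OF N, of det] M by (simp add: det_mul SL_def)
  ultimately show "\<exists>N\<in>carrier SL. N \<otimes>\<^bsub>SL\<^esub> M = \<one>\<^bsub>SL\<^esub>"
    by (auto simp: SL_def)
qed (auto simp: SL_def det_mul matrix_mul_assoc)

lemma mat_mult_left: "mat c ** M = (\<chi> i j. c * M $ i $ j)"
  for M :: "'k::{field,finite} ^ 'n::finite ^ 'n"
  by (simp add: matrix_matrix_mult_def mat_def vec_eq_iff if_distrib[of "\<lambda>x. x * _"] cong: if_cong)

lemma mat_mult_right: "M ** mat c = (\<chi> i j. c * M $ i $ j)"
  for M :: "'k::{field,finite} ^ 'n::finite ^ 'n"
  by (simp add: matrix_matrix_mult_def mat_def vec_eq_iff if_distrib[of "\<lambda>x. _ * x"] mult.commute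
      cong: if_cong)

lemma normal_SZ: "(SZ :: ('k::{field,finite} ^ 'n::finite ^ 'n) set) \<lhd> SL"
proof -
  interpret group "SL :: ('k ^ 'n ^ 'n) monoid" by (rule group_SL)
  have central: "M \<otimes>\<^bsub>SL\<^esub> z = z \<otimes>\<^bsub>SL\<^esub> M" if "z \<in> SZ" for M z :: "'k ^ 'n ^ 'n"
    using that by (auto simp: SZ_def SL_def mat_mult_left mat_mult_right)
  have sub: "subgroup (SZ :: ('k ^ 'n ^ 'n) set) SL"
  proof (rule subgroupI)
    have "mat 1 \<in> (SZ :: ('k ^ 'n ^ 'n) set)" by (simp add: SZ_def SL_def)
    then show "SZ \<noteq> ({} :: ('k ^ 'n ^ 'n) set)" by blast
  next
    fix z :: "'k ^ 'n ^ 'n"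
    assume z: "z \<in> SZ"
    then obtain c where c: "z = mat c" and zc: "z \<in> carrier SL" by (auto simp: SZ_def)
    have "c \<noteq> 0"
    proof
      assume "c = 0"
      then have "z = 0" by (simp add: c mat_def vec_eq_iff)
      then show False using zc by (simp add: SL_def flip: mat_0)
    qed
    then have mul: "mat (inverse c) ** z = mat 1"
      unfolding c mat_mult_left by (simp add: mat_def vec_eq_iff)
    have "det (mat (inverse c) :: 'k ^ 'n ^ 'n) = 1"
      using arg_cong[OF mul, of det] zc by (simp add: det_mul SL_def)
    then have "(mat (inverse c) :: 'k ^ 'n ^ 'n) \<in> carrier SL" by (simp add: SL_def)
    moreover from this have "inv\<^bsub>SL\<^esub> z = mat (inverse c)"
      using mul zc by (intro inv_equality) (auto simp: SL_def)
    ultimately show "inv\<^bsub>SL\<^esub> z \<in> SZ" by (simp add: SZ_def)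
  next
    fix y z :: "'k ^ 'n ^ 'n"
    assume yz: "y \<in> SZ" "z \<in> SZ"
    then obtain b c where bc: "y = mat b" "z = mat c" by (auto simp: SZ_def)
    have "y ** z = mat (b * c)"
      unfolding bc mat_mult_left by (simp add: mat_def vec_eq_iff)
    moreover have "det (y ** z) = 1"
      using yz by (simp add: SZ_def SL_def det_mul)
    ultimately show "y \<otimes>\<^bsub>SL\<^esub> z \<in> SZ" by (simp add: SZ_def SL_def)
  qed (auto simp: SZ_def)
  have "M \<otimes>\<^bsub>SL\<^esub> z \<otimes>\<^bsub>SL\<^esub> inv\<^bsub>SL\<^esub> M = z"
    if "M \<in> carrier SL" "z \<in> SZ" for M z :: "'k ^ 'n ^ 'n"
    unfolding central[OF that(2)] using that subgroup.mem_carrier[OF sub] by (simp add: m_assoc)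
  with sub show ?thesis by (simp add: normal_inv_iff)
qed

lemma group_PSL: "group (PSL :: ('k::{field,finite} ^ 'n::finite ^ 'n) set monoid)"
  unfolding PSL_def by (rule normal.factorgroup_is_group[OF normal_SZ])

lemma PSL_act_eq:
  fixes g :: "('k::{field,finite} ^ 'n::finite ^ 'n) set"
  assumes g: "g \<in> carrier PSL" and M: "M \<in> g" and W: "vec.subspace W"
  shows "PSL_act g W = (*v) M ` W"
proof -
  have sub: "(*v) P ` W \<subseteq> (*v) Q ` W" if P: "P \<in> g" and Q: "Q \<in> g" for P Q
  proof -
    interpret normal SZ "SL :: ('k ^ 'n ^ 'n) monoid" by (rule normal_SZ)
    from g obtain N where N: "N \<in> carrier SL" "g = SZ #>\<^bsub>SL\<^esub> N"
      by (auto simp: PSL_def FactGroup_def RCOSETS_def)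
    then have "g = SZ #>\<^bsub>SL\<^esub> Q" using Q repr_independence subgroup_axioms by blast
    with P obtain c where "P = mat c ** Q"
      by (auto simp: r_coset_def SZ_def SL_def)
    then have "P *v w = Q *v (c *s w)" for w
      by (simp add: mat_mult_left matrix_vector_mult_def vec_eq_iff sum_distrib_left mult_ac)
    then show ?thesis using W by (auto intro!: imageI vec.subspace_scale)
  qed
  show ?thesis unfolding PSL_act_def using sub[OF _ M] M by blast
qed

end

theory Submission
  imports Defs
begin

text \<open>
  Let \<open>q\<close> be the size of the field, \<open>N\<close> the number of lines of \<open>V\<close>, and \<open>f\<close> the number of fixed
  lines. The argument runs in \<open>SL\<close>, with representatives \<open>a\<close>, \<open>b\<close> of the two classes; they are not
  scalar. The products \<open>a b\<^sup>g\<close>, for \<open>b\<^sup>g\<close> a conjugate of \<open>b\<close>, meet every conjugacy class that meets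
  \<open>AB\<close>. Lines are counted through the vectors that span them: the eigenvectors of \<open>M\<close> number
  \<open>(q - 1) f(M)\<close>.

  Since \<open>SL\<close> is doubly transitive on lines, \<open>f - 1\<close> is an irreducible character of degree \<open>N - 1\<close>, so
  its average over the products \<open>a b\<^sup>g\<close> is \<open>(f(a) - 1) (f(b) - 1) / (N - 1)\<close>. No character theory is
  used to see this: \<open>conj_average\<close> gets it by counting. So if \<open>f\<close> is constant on \<open>AB\<close>, its value \<open>m\<close>
  satisfies \<open>(m - 1) (N - 1) = (f(a) - 1) (f(b) - 1)\<close>. On the other hand a non-scalar matrix has few
  fixed lines: \<open>q (f(a) - 1) \<le> N - 1\<close> (\<open>eigenvectors_bound\<close>). Together these leave two cases.

  \<^item> Both \<open>f(a)\<close> and \<open>f(b)\<close> are at least \<open>2\<close>. Put the largest eigenspace of a conjugate of one factor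
    inside the largest eigenspace of the other; the product then fixes all lines of the smaller
    eigenspace, which is more than the equation allows.

  \<^item> One of them, say \<open>f(a)\<close>, is \<open>1\<close>, and then \<open>m = 1\<close>. It remains to find a conjugate of \<open>b\<close> for
    which \<open>a b\<^sup>g\<close> does not have exactly one fixed line. If \<open>V\<close> has dimension at least \<open>3\<close>, there are
    even two fixed lines (\<open>two_fixed_lines\<close>): it suffices that \<open>b\<^sup>g\<close> and the inverse of \<open>a\<close> agree on two
    lines, and \<open>SL\<close> is transitive on linearly independent families of lines, so \<open>b\<close> and the
    inverse of \<open>a\<close> only need to act in the same pattern on some such family. In dimension \<open>2\<close> a
    determinant-one matrix with a single fixed line has trace \<open>2\<close> or \<open>-2\<close>, whereas the traces of the
    products \<open>a b\<^sup>g\<close> include the values of a non-constant quadratic polynomial on the field. This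
    forces \<open>q \<le> 3\<close> (\<open>field_size_of_constant_one_line\<close>).

  The exceptions \<open>PSL\<^sub>2(2)\<close> and \<open>PSL\<^sub>2(3)\<close> do violate the conclusion, so simplicity has to enter. It does
  so in \<open>PSL2_not_simple\<close>: in these groups the elements with one fixed line are permuted by right
  multiplication with a non-trivial element, which cannot happen in a simple group.
\<close>

section \<open>Special linear groups acting on independent families of lines\<close>

text \<open>
  Families are lists, so that two of them can be matched entry by entry.
\<close>

definition lin_indep :: "('k::{field,finite} ^ 'n::finite) list \<Rightarrow> bool" where
  "lin_indep xs \<longleftrightarrow> distinct xs \<and> vec.independent (set xs)"

lemma lin_indep_Nil [simp]: "lin_indep []"
  by (simp add: lin_indep_def vec.independent_empty)

lemma lin_indep_Cons: "lin_indep (x # xs) \<longleftrightarrow> x \<notin> vec.span (set xs) \<and> lin_indep xs"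
  by (auto simp: lin_indep_def vec.independent_insert vec.span_base)

lemma lin_indep_length:
  fixes xs :: "('k::{field,finite} ^ 'n::finite) list"
  assumes "lin_indep xs" shows "length xs \<le> CARD('n)"
proof -
  have "card (set xs) \<le> vec.dim (UNIV :: ('k ^ 'n) set)"
    using assms by (intro vec.independent_card_le_dim) (auto simp: lin_indep_def)
  then show ?thesis using assms by (simp add: lin_indep_def distinct_card vec_dim_card del: vec.dim_UNIV)
qed

lemma lin_indep_extend:
  fixes us :: "('k::{field,finite} ^ 'n::finite) list"
  assumes "lin_indep us"
  obtains ws where "lin_indep (us @ ws)" "length (us @ ws) = CARD('n)"
proof -
  obtain B where B: "set us \<subseteq> B" "vec.independent B" "UNIV \<subseteq> vec.span B"
    using vec.maximal_independent_subset_extend[of "set us" UNIV] assms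
    by (auto simp: lin_indep_def)
  have fin: "finite B" using B(2) vec.finiteI_independent by blast
  then obtain ws where ws: "set ws = B - set us" "distinct ws"
    using finite_distinct_list[of "B - set us"] by auto
  have s: "set (us @ ws) = B" using ws B(1) by auto
  have d: "distinct (us @ ws)" using ws assms by (auto simp: lin_indep_def)
  have "card B = vec.dim (UNIV :: ('k ^ 'n) set)"
    using B by (intro vec.basis_card_eq_dim) auto
  then have "length (us @ ws) = CARD('n)"
    using distinct_card[OF d] s by (simp add: vec_dim_card del: vec.dim_UNIV)
  moreover have "lin_indep (us @ ws)" using d s B by (simp add: lin_indep_def)
  ultimately show ?thesis using that by blast
qed

lemma matrix_vector_axis:
  fixes M :: "'k::{field,finite} ^ 'n::finite ^ 'n"
  shows "(M *v axis j 1) $ i = M $ i $ j"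
  by (simp add: matrix_vector_mult_def axis_def if_distrib[of "\<lambda>x. _ * x"] cong: if_cong)

lemma mat_mult_vector: "mat c *v x = c *s x"
  for x :: "'k::{field,finite} ^ 'n::finite"
  by (simp add: matrix_vector_mult_def mat_def vec_eq_iff if_distrib[of "\<lambda>x. x * _"] cong: if_cong)

text \<open>
  The matrix has the given basis as its columns, in the order of coordinates prescribed by \<open>ns\<close>. It
  serves to carry one basis to another by way of the standard basis.
\<close>

lemma lin_indep_matrix:
  fixes us :: "('k::{field,finite} ^ 'n::finite) list" and ns :: "'n list"
  assumes us: "lin_indep us" "length us = CARD('n)" and ns: "distinct ns" "set ns = UNIV"
  obtains P :: "'k ^ 'n ^ 'n"
  where "det P \<noteq> 0" "\<And>i. i < CARD('n) \<Longrightarrow> P *v axis (ns ! i) 1 = us ! i"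
proof -
  have len: "length ns = CARD('n)" using ns distinct_card by fastforce
  define P :: "'k ^ 'n ^ 'n" where "P = (\<chi> r j. (us ! (THE i. i < CARD('n) \<and> ns ! i = j)) $ r)"
  have idx: "(THE i'. i' < CARD('n) \<and> ns ! i' = ns ! i) = i" if "i < CARD('n)" for i
    using that ns(1) len by (intro the_equality) (auto simp: nth_eq_iff_index_eq)
  have col: "P *v axis (ns ! i) 1 = us ! i" if "i < CARD('n)" for i
    using idx[OF that] by (simp add: vec_eq_iff matrix_vector_axis) (simp add: P_def)
  have "range ((*v) P) = UNIV"
  proof -
    have "vec.subspace (range ((*v) P))"
      using vec.subspace_image[OF vec.subspace_UNIV] by blast
    moreover have "set us \<subseteq> range ((*v) P)"
      using col us(2) by (auto simp: set_conv_nth) (metis rangeI)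
    ultimately have "vec.span (set us) \<subseteq> range ((*v) P)"
      by (intro vec.span_minimal)
    moreover have "UNIV \<subseteq> vec.span (set us)"
      using us vec.card_ge_dim_independent[of "set us" UNIV] distinct_card[of us]
      by (simp add: lin_indep_def vec_dim_card del: vec.dim_UNIV)
    ultimately show ?thesis by blast
  qed
  then have "invertible P"
    by (metis invertible_right_inverse matrix_right_invertible_surjective)
  then have "det P \<noteq> 0" by (simp add: invertible_det_nz)
  with col show ?thesis using that by blast
qed

text \<open>
  Matching lines rather than vectors leaves a scalar free, and this scalar brings the determinant
  to \<open>1\<close>: extend both families to bases, send the first basis to the standard one, rescale one
  coordinate there, and continue to the second basis. For two vectors this is double transitivity
  on lines.
\<close>

lemma SL_transitive_on_frames:
  fixes us xs :: "('k::{field,finite} ^ 'n::finite) list"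
  assumes "lin_indep us" "lin_indep xs" "length us = length xs"
  obtains g :: "'k ^ 'n ^ 'n"
  where "det g = 1" "\<And>i. i < length us \<Longrightarrow> g *v (us ! i) \<in> vec.span {xs ! i}"
proof -
  obtain us' where us': "lin_indep (us @ us')" "length (us @ us') = CARD('n)"
    using lin_indep_extend assms(1) by blast
  obtain xs' where xs': "lin_indep (xs @ xs')" "length (xs @ xs') = CARD('n)"
    using lin_indep_extend assms(2) by blast
  obtain ns :: "'n list" where ns: "distinct ns" "set ns = UNIV"
    using finite_distinct_list[of "UNIV :: 'n set"] by auto
  obtain P where P: "det P \<noteq> 0" "\<And>i. i < CARD('n) \<Longrightarrow> P *v axis (ns ! i) 1 = (us @ us') ! i"
    using lin_indep_matrix[OF us' ns] by blast
  obtain R where R: "det R \<noteq> 0" "\<And>i. i < CARD('n) \<Longrightarrow> R *v axis (ns ! i) 1 = (xs @ xs') ! i"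
    using lin_indep_matrix[OF xs' ns] by blast
  \<comment> \<open>Rescaling the first coordinate compensates the quotient of the two determinants.\<close>
  define s where "s = (\<lambda>j. if j = ns ! 0 then det P / det R else 1)"
  define D :: "'k ^ 'n ^ 'n" where "D = (\<chi> i j. if i = j then s j else 0)"
  have "det D = (\<Prod>i\<in>UNIV. s i)"
    by (subst det_diagonal) (auto simp: D_def)
  also have "\<dots> = det P / det R" by (simp add: s_def)
  finally have D: "det D = det P / det R" .
  have Dax: "D *v axis j 1 = s j *s axis j 1" for j
    by (simp add: vec_eq_iff matrix_vector_axis) (simp add: D_def axis_def)
  obtain P' where P': "P' ** P = mat 1"
    using P(1) invertible_det_nz invertible_left_inverse by metis
  have P'd: "det P' * det P = 1" using arg_cong[OF P', of det] by (simp add: det_mul)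
  define g where "g = R ** D ** P'"
  have "det g = 1" using P'd P(1) R(1) by (simp add: g_def det_mul D mult.commute)
  moreover have "g *v (us ! i) \<in> vec.span {xs ! i}" if i: "i < length us" for i
  proof -
    have i': "i < CARD('n)" using i us'(2) by simp
    have "us ! i = P *v axis (ns ! i) 1" using P(2)[OF i'] i by (simp add: nth_append)
    then have "P' *v (us ! i) = axis (ns ! i) 1" using P' by (simp add: matrix_vector_mul_assoc)
    then have "g *v (us ! i) = R *v (D *v axis (ns ! i) 1)"
      by (simp add: g_def flip: matrix_vector_mul_assoc)
    also have "\<dots> = s (ns ! i) *s xs ! i"
      using R(2)[OF i'] i assms(3) by (simp add: Dax vec.scale nth_append)
    finally show ?thesis by (simp add: vec.span_base vec.span_scale)
  qed
  ultimately show ?thesis using that by blast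
qed

definition conj_by :: "'k::{field,finite} ^ 'n::finite ^ 'n \<Rightarrow> 'k ^ 'n ^ 'n \<Rightarrow> 'k ^ 'n ^ 'n" where
  "conj_by g M = g ** M ** matrix_inv g"

text \<open>
  The vectors that span a fixed line; the eigenvalue is left implicit.
\<close>

definition eigenvectors :: "'k::{field,finite} ^ 'n::finite ^ 'n \<Rightarrow> ('k ^ 'n) set" where
  "eigenvectors M = {x. x \<noteq> 0 \<and> M *v x \<in> vec.span {x}}"

lemma matrix_inv_mult:
  fixes g :: "'k::{field,finite} ^ 'n::finite ^ 'n"
  assumes "det g = 1"
  shows "matrix_inv g ** g = mat 1" "g ** matrix_inv g = mat 1" "det (matrix_inv g) = 1"
proof -
  have "invertible g" using assms by (simp add: invertible_det_nz)
  then show 1: "matrix_inv g ** g = mat 1" and 2: "g ** matrix_inv g = mat 1"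
    using someI_ex[of "\<lambda>B. g ** B = mat 1 \<and> B ** g = mat 1"]
    unfolding invertible_def matrix_inv_def by auto
  show "det (matrix_inv g) = 1" using arg_cong[OF 1, of det] assms by (simp add: det_mul)
qed

lemma conj_by_apply:
  assumes "det g = 1" shows "conj_by g M *v (g *v x) = g *v (M *v x)"
  using matrix_inv_mult[OF assms]
  by (simp add: conj_by_def matrix_vector_mul_assoc flip: matrix_mul_assoc)

lemma det_conj_by: "det g = 1 \<Longrightarrow> det (conj_by g M) = det M"
  using matrix_inv_mult[of g] by (simp add: conj_by_def det_mul)

lemma det_1_inj: "det g = 1 \<Longrightarrow> g *v x = g *v y \<longleftrightarrow> x = y" for g :: "'k::{field,finite} ^ 'n::finite ^ 'n"
  using matrix_inv_mult[of g] by (metis matrix_vector_mul_assoc matrix_vector_mul_lid)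

lemma det_1_surj:
  fixes g :: "'k::{field,finite} ^ 'n::finite ^ 'n"
  assumes "det g = 1" obtains x where "y = g *v x"
  using matrix_inv_mult[OF assms] by (metis matrix_vector_mul_assoc matrix_vector_mul_lid)

lemma matrix_vector_span:
  "x \<in> vec.span S \<Longrightarrow> g *v x \<in> vec.span ((*v) g ` S)"
  for g :: "'k::{field,finite} ^ 'n::finite ^ 'n"
  using vec.span_image[of g S] by auto

lemma det_1_span_iff:
  fixes g :: "'k::{field,finite} ^ 'n::finite ^ 'n"
  assumes "det g = 1"
  shows "g *v x \<in> vec.span ((*v) g ` S) \<longleftrightarrow> x \<in> vec.span S"
  using vec.span_image[of g S] det_1_inj[OF assms] by auto

lemma conj_by_mult:
  assumes "det g = 1" "det h = 1"
  shows "conj_by (g ** h) M = conj_by g (conj_by h M)"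
proof -
  have d: "det (g ** h) = 1" using assms by (simp add: det_mul)
  have "conj_by (g ** h) M *v y = conj_by g (conj_by h M) *v y" for y
  proof -
    obtain x where y: "y = (g ** h) *v x" using det_1_surj[OF d] by blast
    show ?thesis
      using conj_by_apply[OF d, of M x] conj_by_apply[OF assms(1), of "conj_by h M" "h *v x"]
        conj_by_apply[OF assms(2), of M x]
      by (simp add: y flip: matrix_vector_mul_assoc)
  qed
  then show ?thesis by (simp add: matrix_eq)
qed

lemma conj_by_matrix_mult:
  "det g = 1 \<Longrightarrow> conj_by g (M ** N) = conj_by g M ** conj_by g N"
  for M :: "'k::{field,finite} ^ 'n::finite ^ 'n"
proof -
  assume g: "det g = 1"
  have "conj_by g M ** conj_by g N = g ** M ** (matrix_inv g ** g) ** N ** matrix_inv g"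
    by (simp only: conj_by_def matrix_mul_assoc)
  then show ?thesis using matrix_inv_mult(1)[OF g] by (simp add: conj_by_def matrix_mul_assoc)
qed

lemma matrix_inv_mat_1: "matrix_inv (mat 1 :: 'k::{field,finite} ^ 'n::finite ^ 'n) = mat 1"
  using matrix_inv_mult(1)[of "mat 1 :: 'k ^ 'n ^ 'n"] by simp

lemma conj_by_mat_1 [simp]: "conj_by (mat 1) M = M"
  by (simp add: conj_by_def matrix_inv_mat_1)

lemma trace_conj_by:
  fixes M :: "'k::{field,finite} ^ 'n::finite ^ 'n"
  assumes "det g = 1" shows "trace (conj_by g M) = trace M"
proof -
  have "trace (conj_by g M) = trace (matrix_inv g ** (g ** M))"
    unfolding conj_by_def by (rule trace_mul_sym)
  then show ?thesis using matrix_inv_mult(1)[OF assms] by (simp add: matrix_mul_assoc)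
qed

lemma conj_by_scalar_iff:
  fixes M :: "'k::{field,finite} ^ 'n::finite ^ 'n"
  assumes g: "det g = 1" shows "conj_by g M \<in> range mat \<longleftrightarrow> M \<in> range mat"
proof -
  have fixd: "conj_by h (mat c) = mat c" if "det h = 1" for h :: "'k ^ 'n ^ 'n" and c
  proof -
    have "h ** mat c = mat c ** h" by (simp add: mat_mult_left mat_mult_right)
    then have "conj_by h (mat c) = mat c ** (h ** matrix_inv h)"
      by (simp add: conj_by_def matrix_mul_assoc)
    then show ?thesis using matrix_inv_mult(2)[OF that] by simp
  qed
  have "conj_by (matrix_inv g) (conj_by g M) = M"
    using conj_by_mult[OF matrix_inv_mult(3)[OF g] g, of M] matrix_inv_mult(1)[OF g] by simp
  then show ?thesis using fixd[OF g] fixd[OF matrix_inv_mult(3)[OF g]] by (metis imageE rangeI)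
qed

lemma eigenvectors_conj_by:
  assumes "det g = 1"
  shows "eigenvectors (conj_by g M) = (*v) g ` eigenvectors M"
proof -
  have *: "g *v x \<in> eigenvectors (conj_by g M) \<longleftrightarrow> x \<in> eigenvectors M" for x
    using det_1_span_iff[OF assms, of "M *v x" "{x}"] det_1_inj[OF assms, of x 0]
    by (simp add: eigenvectors_def conj_by_apply[OF assms])
  show ?thesis
  proof (intro equalityI subsetI)
    fix y assume "y \<in> eigenvectors (conj_by g M)"
    moreover obtain x where "y = g *v x" using det_1_surj[OF assms] by blast
    ultimately show "y \<in> (*v) g ` eigenvectors M" using * by auto
  qed (use * in auto)
qed

lemma card_eigenvectors_conj_by:
  assumes "det g = 1"
  shows "card (eigenvectors (conj_by g M)) = card (eigenvectors M)"
  unfolding eigenvectors_conj_by[OF assms]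
  using det_1_inj[OF assms] by (intro card_image inj_onI) auto

lemma span_singleton_sym:
  fixes x y :: "'k::{field,finite} ^ 'n::finite"
  assumes "x \<in> vec.span {y}" "x \<noteq> 0" shows "vec.span {x} = vec.span {y}"
proof -
  obtain c where c: "x = c *s y" using assms(1) by (auto simp: vec.span_singleton)
  with assms(2) have "c \<noteq> 0" by auto
  then have "y = inverse c *s x" using c by simp
  then have "y \<in> vec.span {x}" by (simp add: vec.span_base vec.span_scale)
  then show ?thesis using assms(1) by (simp add: vec.span_eq)
qed

lemma card_span_singleton:
  fixes x :: "'k::{field,finite} ^ 'n::finite"
  assumes "x \<noteq> 0" shows "card (vec.span {x}) = CARD('k)"
proof -
  have "inj (\<lambda>c. c *s x)" using assms by (auto intro!: injI)
  then show ?thesis unfolding vec.span_singleton by (rule card_image)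
qed

lemma span_singleton_commute:
  fixes x y :: "'k::{field,finite} ^ 'n::finite"
  assumes "x \<noteq> 0" "y \<noteq> 0"
  shows "x \<in> vec.span {y} \<longleftrightarrow> y \<in> vec.span {x}"
proof -
  have "x \<in> vec.span {x}" "y \<in> vec.span {y}" by (simp_all add: vec.span_base)
  then show ?thesis using span_singleton_sym[of x y] span_singleton_sym[of y x] assms by blast
qed

section \<open>The average number of eigenvectors of a product\<close>

lemma CARD_gt_1: "CARD('k::{field,finite}) > 1"
  using card_mono[of UNIV "{0, 1 :: 'k}"] by simp

lemma eigenvectors_matrix_inv:
  fixes a :: "'k::{field,finite} ^ 'n::finite ^ 'n"
  assumes a: "det a = 1"
  shows "eigenvectors (matrix_inv a) = eigenvectors a"
proof -
  have "matrix_inv a *v x \<in> vec.span {x} \<longleftrightarrow> a *v x \<in> vec.span {x}" if x: "x \<noteq> 0" for x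
  proof -
    let ?y = "matrix_inv a *v x"
    have ay: "a *v ?y = x" using matrix_inv_mult(2)[OF a] by (simp add: matrix_vector_mul_assoc)
    have y: "?y \<noteq> 0" using det_1_inj[OF matrix_inv_mult(3)[OF a], of x 0] x by simp
    have "a *v x \<in> vec.span {x} \<longleftrightarrow> a *v x \<in> vec.span {a *v ?y}" by (simp only: ay)
    also have "\<dots> \<longleftrightarrow> x \<in> vec.span {?y}" using det_1_span_iff[OF a, of x "{?y}"] by simp
    also have "\<dots> \<longleftrightarrow> ?y \<in> vec.span {x}" by (rule span_singleton_commute[OF x y])
    finally show ?thesis by simp
  qed
  then show ?thesis unfolding eigenvectors_def by blast
qed

lemma matrix_maps_line_cong:
  fixes M :: "'k::{field,finite} ^ 'n::finite ^ 'n"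
  assumes "vec.span {x} = vec.span {x'}" "M *v x \<in> vec.span {y}"
  shows "M *v x' \<in> vec.span {y}"
proof -
  have "x' \<in> vec.span {x}" using assms(1) by (simp add: vec.span_base)
  then obtain c where "x' = c *s x" by (auto simp: vec.span_singleton)
  then show ?thesis using assms(2) by (simp add: vec.scale vec.span_scale)
qed

text \<open>
  Translation by \<open>h\<close> is a bijection between the two sets of conjugators, because conjugating by \<open>h\<close>
  moves the pair of lines \<open>(x, y)\<close> to \<open>(x', y')\<close>. With transitivity, the number of conjugates of \<open>b\<close>
  that map one line to another only depends on whether the two lines are equal.
\<close>

lemma card_conj_by_maps_line:
  fixes b :: "'k::{field,finite} ^ 'n::finite ^ 'n"
  assumes h: "det h = 1" and xy: "x \<noteq> 0" "y \<noteq> 0"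
    and hx: "h *v x \<in> vec.span {x'}" and hy: "h *v y \<in> vec.span {y'}"
  shows "card {g. det g = 1 \<and> conj_by g b *v x' \<in> vec.span {y'}}
    = card {g. det g = 1 \<and> conj_by g b *v x \<in> vec.span {y}}" (is "card ?S' = card ?S")
proof -
  have "h *v x \<noteq> 0" "h *v y \<noteq> 0" using det_1_inj[OF h, of _ 0] xy by auto
  then have sp: "vec.span {h *v x} = vec.span {x'}" "vec.span {h *v y} = vec.span {y'}"
    using hx hy span_singleton_sym by blast+
  have iff: "conj_by (h ** g) b *v x' \<in> vec.span {y'} \<longleftrightarrow> conj_by g b *v x \<in> vec.span {y}"
    if g: "det g = 1" for g
  proof -
    have "conj_by (h ** g) b *v x' \<in> vec.span {y'}
      \<longleftrightarrow> conj_by (h ** g) b *v (h *v x) \<in> vec.span {h *v y}"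
      unfolding sp(2) using matrix_maps_line_cong[OF sp(1)] matrix_maps_line_cong[OF sp(1)[symmetric]] by blast
    also have "\<dots> \<longleftrightarrow> h *v (conj_by g b *v x) \<in> vec.span ((*v) h ` {y})"
      using conj_by_mult[OF h g] conj_by_apply[OF h] by simp
    finally show ?thesis using det_1_span_iff[OF h] by blast
  qed
  have "?S' = (**) h ` ?S"
  proof (intro equalityI subsetI)
    fix g assume g: "g \<in> ?S'"
    have e: "g = h ** (matrix_inv h ** g)"
      by (simp add: matrix_mul_assoc matrix_inv_mult[OF h])
    have d: "det (matrix_inv h ** g) = 1" using g matrix_inv_mult[OF h] by (simp add: det_mul)
    have "matrix_inv h ** g \<in> ?S" using g d iff[OF d] e by simp
    then show "g \<in> (**) h ` ?S" using e by blast
  next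
    fix g' assume "g' \<in> (**) h ` ?S"
    then obtain g where g: "g' = h ** g" "det g = 1" "conj_by g b *v x \<in> vec.span {y}" by blast
    then show "g' \<in> ?S'" using iff[OF g(2)] h by (simp add: det_mul)
  qed
  moreover have "inj ((**) h)"
    by (rule inj_on_inverseI[of _ "(**) (matrix_inv h)"])
      (simp add: matrix_mul_assoc matrix_inv_mult[OF h])
  ultimately show ?thesis using card_image[OF inj_on_subset[OF _ subset_UNIV]] by simp
qed

lemma card_outside_span_singleton:
  fixes x :: "'k::{field,finite} ^ 'n::finite"
  assumes "x \<noteq> 0"
  shows "card (- vec.span {x}) + CARD('k) = CARD('k ^ 'n)"
  using card_span_singleton[OF assms] card_Un_disjoint[of "- vec.span {x}" "vec.span {x}"]
  by (simp add: Compl_partition2)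

text \<open>
  If \<open>z\<close> is the image of \<open>x\<close> under some matrix, this counts the vectors \<open>y\<close> off the line of \<open>x\<close> such
  that the matrix maps the line of \<open>x\<close> to the line of \<open>y\<close>.
\<close>

lemma card_generators_outside_line:
  fixes x z :: "'k::{field,finite} ^ 'n::finite"
  assumes z: "z \<noteq> 0"
  shows "card {y \<in> - vec.span {x}. z \<in> vec.span {y}} = (if z \<in> vec.span {x} then 0 else CARD('k) - 1)"
proof -
  have line: "z \<in> vec.span {y} \<longleftrightarrow> y \<in> vec.span {z} - {0}" for y
    using span_singleton_commute[OF z, of y] z by (cases "y = 0") simp_all
  have "y \<in> vec.span {x} \<longleftrightarrow> z \<in> vec.span {x}" if "y \<in> vec.span {z} - {0}" for y
  proof -
    have "vec.span {y} = vec.span {z}" using span_singleton_sym[of y z] that by simp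
    moreover have "w \<in> vec.span {x} \<longleftrightarrow> vec.span {w} \<subseteq> vec.span {x}" for w
      using vec.span_minimal[of "{w}" "vec.span {x}"] vec.span_base[of w "{w}"] by auto
    ultimately show ?thesis by simp
  qed
  then have "{y \<in> - vec.span {x}. z \<in> vec.span {y}}
    = (if z \<in> vec.span {x} then {} else vec.span {z} - {0})"
    unfolding line by auto
  then show ?thesis using card_span_singleton[OF z] by (simp add: vec.span_zero)
qed

text \<open>
  Count pairs \<open>(g, x)\<close> for which \<open>x\<close> is an eigenvector of \<open>a b\<^sup>g\<close>, that is, for which \<open>b\<^sup>g\<close> maps the line
  of \<open>x\<close> to its image under the inverse of \<open>a\<close>. For a fixed \<open>x\<close> the number of such \<open>g\<close> has one value
  when \<open>x\<close> is an eigenvector of \<open>a\<close> and another value when it is not, by double transitivity.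
  Summing over all possible target lines expresses both values through the number of eigenvectors
  of \<open>b\<close>. Divided by \<open>(q - 1)\<^sup>2\<close>, the identity is \<open>(m - 1) (N - 1) = (f(a) - 1) (f(b) - 1)\<close> for the
  numbers of lines.
\<close>

lemma conj_average:
  fixes a b :: "'k::{field,finite} ^ 'n::finite ^ 'n"
  assumes a: "det a = 1" and b: "det b = 1" and n: "CARD('n) \<ge> 2"
    and m: "\<And>g. det g = 1 \<Longrightarrow> card (eigenvectors (a ** conj_by g b)) = m"
  shows "(int m - (int CARD('k) - 1)) * (int CARD('k ^ 'n) - int CARD('k))
    = (int (card (eigenvectors a)) - (int CARD('k) - 1)) * (int (card (eigenvectors b)) - (int CARD('k) - 1))"
proof -
  define G where "G = {g :: 'k ^ 'n ^ 'n. det g = 1}"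
  \<comment> \<open>the number of \<open>g\<close> for which \<open>b\<^sup>g\<close> maps the line of \<open>x\<close> to the line of \<open>y\<close>\<close>
  define N where "N = (\<lambda>x y. card {g \<in> G. conj_by g b *v x \<in> vec.span {y}})"
  let ?q = "int CARD('k)" and ?Q = "int CARD('k ^ 'n)"
  let ?a = "int (card (eigenvectors a))" and ?b = "int (card (eigenvectors b))"
  let ?G = "int (card G)"
  have "mat 1 \<in> G" by (simp add: G_def)
  then have Gpos: "?G > 0" by (auto simp: card_gt_0_iff)
  have dc: "(\<Sum>x\<in>X. card {g \<in> G. R g x}) = (\<Sum>g\<in>G. card {x \<in> X. R g x})"
    for R and X :: "('k ^ 'n) set"
    unfolding card_eq_sum by (rule sum.swap_restrict) auto
  define x0 :: "'k ^ 'n" where "x0 = axis undefined 1"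
  then have x0: "x0 \<noteq> 0" by simp
  have cN0: "card {x :: 'k ^ 'n. x \<noteq> 0} = CARD('k ^ 'n) - 1"
  proof -
    have "{x :: 'k ^ 'n. x \<noteq> 0} = UNIV - {0}" by auto
    then show ?thesis by (simp add: card_Diff_singleton)
  qed
  have Qgt: "CARD('k ^ 'n) > 1"
    using x0 card_mono[of UNIV "{0, x0}"] by (simp add: card_insert_if)
  have qgt: "CARD('k) > 1" by (rule CARD_gt_1)
  have N_inv: "N x' y' = N x y"
    if "det h = 1" "x \<noteq> 0" "y \<noteq> 0" "h *v x \<in> vec.span {x'}" "h *v y \<in> vec.span {y'}" for h x y x' y'
    using card_conj_by_maps_line[OF that] by (simp add: N_def G_def)
  have N1: "N x x = N x0 x0" if "x \<noteq> 0" for x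
  proof -
    have "lin_indep [x0]" "lin_indep [x]" using x0 that by (simp_all add: lin_indep_Cons)
    then obtain h :: "'k ^ 'n ^ 'n"
      where h: "det h = 1" "\<And>i. i < length [x0] \<Longrightarrow> h *v ([x0] ! i) \<in> vec.span {[x] ! i}"
      by (rule SL_transitive_on_frames) auto
    show ?thesis using N_inv[OF h(1) x0 x0] h(2)[of 0] by simp
  qed
  have "(\<Sum>x\<in>{x. x \<noteq> 0}. N x x) = (\<Sum>g\<in>G. card (eigenvectors (conj_by g b)))"
    using dc[of "\<lambda>g x. conj_by g b *v x \<in> vec.span {x}" "{x. x \<noteq> 0}"]
    by (simp add: N_def eigenvectors_def)
  also have "\<dots> = card G * card (eigenvectors b)"
    by (simp add: G_def card_eigenvectors_conj_by)
  finally have "(\<Sum>x\<in>{x. x \<noteq> 0}. N x x) = card G * card (eigenvectors b)" .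
  moreover have "(\<Sum>x\<in>{x. x \<noteq> 0}. N x x) = (\<Sum>x :: 'k ^ 'n\<in>{x. x \<noteq> 0}. N x0 x0)"
    by (rule sum.cong[OF refl], rule N1) simp
  ultimately have "(CARD('k ^ 'n) - 1) * N x0 x0 = card G * card (eigenvectors b)"
    by (simp add: cN0)
  then have "int ((CARD('k ^ 'n) - 1) * N x0 x0) = ?G * ?b" by simp
  then have e1: "(?Q - 1) * int (N x0 x0) = ?G * ?b" using Qgt by (simp add: of_nat_diff)
  have "vec.span {x0} \<noteq> UNIV"
    using vec.dim_le_card[of UNIV "{x0}"] n by (auto simp: vec_dim_card simp del: vec.dim_UNIV)
  then obtain y0 where y0: "y0 \<notin> vec.span {x0}" by auto
  have N2: "N x y = N x0 y0" if "x \<noteq> 0" "y \<notin> vec.span {x}" for x y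
  proof -
    have "y \<noteq> 0" "y0 \<noteq> 0" using that y0 vec.span_zero by auto
    have "lin_indep [y0, x0]" "lin_indep [y, x]" using x0 y0 that by (simp_all add: lin_indep_Cons)
    then obtain h :: "'k ^ 'n ^ 'n"
      where h: "det h = 1" "\<And>i. i < length [y0, x0] \<Longrightarrow> h *v ([y0, x0] ! i) \<in> vec.span {[y, x] ! i}"
      by (rule SL_transitive_on_frames) auto
    show ?thesis using N_inv[OF h(1) x0 \<open>y0 \<noteq> 0\<close>] h(2)[of 0] h(2)[of 1] by simp
  qed
  have "(\<Sum>y\<in>- vec.span {x0}. N x0 y) = (\<Sum>g\<in>G. card {y \<in> - vec.span {x0}. conj_by g b *v x0 \<in> vec.span {y}})"
    unfolding N_def by (rule dc)
  also have "\<dots> = (\<Sum>g\<in>G. if conj_by g b *v x0 \<in> vec.span {x0} then 0 else CARD('k) - 1)"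
  proof (rule sum.cong)
    fix g assume g: "g \<in> G"
    let ?z = "conj_by g b *v x0"
    have "det (conj_by g b) = 1" using g b by (simp add: G_def det_conj_by)
    then have z: "?z \<noteq> 0" using det_1_inj[of "conj_by g b" x0 0] x0 by auto
    show "card {y \<in> - vec.span {x0}. ?z \<in> vec.span {y}}
      = (if ?z \<in> vec.span {x0} then 0 else CARD('k) - 1)"
      by (rule card_generators_outside_line[OF z])
  qed simp
  also have "\<dots> = (\<Sum>g\<in>{g\<in>G. conj_by g b *v x0 \<notin> vec.span {x0}}. CARD('k) - 1)"
    by (rule sum.mono_neutral_cong_right) auto
  also have "\<dots> = card {g\<in>G. conj_by g b *v x0 \<notin> vec.span {x0}} * (CARD('k) - 1)" by simp
  finally have "(\<Sum>y\<in>- vec.span {x0}. N x0 y)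
    = card {g\<in>G. conj_by g b *v x0 \<notin> vec.span {x0}} * (CARD('k) - 1)" .
  moreover have "(\<Sum>y\<in>- vec.span {x0}. N x0 y) = (\<Sum>y\<in>- vec.span {x0}. N x0 y0)"
    by (rule sum.cong[OF refl], rule N2[OF x0]) simp
  ultimately have "card (- vec.span {x0}) * N x0 y0
    = card {g\<in>G. conj_by g b *v x0 \<notin> vec.span {x0}} * (CARD('k) - 1)"
    by (simp only: sum_constant of_nat_id)
  from arg_cong[OF this, of int]
  have "int (card (- vec.span {x0})) * int (N x0 y0)
    = int (card {g\<in>G. conj_by g b *v x0 \<notin> vec.span {x0}}) * int (CARD('k) - 1)"
    by (simp only: of_nat_mult)
  moreover have "int (card (- vec.span {x0})) = ?Q - ?q"
    using card_outside_span_singleton[OF x0] by linarith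
  moreover have "int (card {g\<in>G. conj_by g b *v x0 \<notin> vec.span {x0}}) = ?G - int (N x0 x0)"
  proof -
    have "card G = N x0 x0 + card {g\<in>G. conj_by g b *v x0 \<notin> vec.span {x0}}"
      unfolding N_def by (subst card_Un_disjoint[symmetric]) (auto intro!: arg_cong[of _ _ card])
    then show ?thesis by linarith
  qed
  ultimately have e2: "(?Q - ?q) * int (N x0 y0) = (?G - int (N x0 x0)) * (?q - 1)"
    using qgt by (simp add: of_nat_diff)
  let ?ia = "matrix_inv a"
  have ia: "a *v z \<in> vec.span {x} \<longleftrightarrow> z \<in> vec.span {?ia *v x}" for z x
    using det_1_span_iff[OF a, of z "{?ia *v x}"] matrix_inv_mult[OF a]
    by (simp add: matrix_vector_mul_assoc)
  have ea: "x \<in> eigenvectors a \<longleftrightarrow> ?ia *v x \<in> vec.span {x}" if "x \<noteq> 0" for x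
    using eigenvectors_matrix_inv[OF a] that unfolding eigenvectors_def by blast
  have "card G * m = (\<Sum>g\<in>G. card (eigenvectors (a ** conj_by g b)))"
    using m by (simp add: G_def)
  also have "\<dots> = (\<Sum>g\<in>G. card {x \<in> {x. x \<noteq> 0}. conj_by g b *v x \<in> vec.span {?ia *v x}})"
    by (simp add: eigenvectors_def ia flip: matrix_vector_mul_assoc)
  also have "\<dots> = (\<Sum>x\<in>{x. x \<noteq> 0}. N x (?ia *v x))"
    unfolding N_def by (rule dc[symmetric])
  also have "\<dots> = (\<Sum>x\<in>{x. x \<noteq> 0}. if x \<in> eigenvectors a then N x0 x0 else N x0 y0)"
  proof (rule sum.cong)
    fix x :: "'k ^ 'n" assume "x \<in> {x. x \<noteq> 0}"
    then have x: "x \<noteq> 0" by simp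
    show "N x (?ia *v x) = (if x \<in> eigenvectors a then N x0 x0 else N x0 y0)"
    proof (cases "x \<in> eigenvectors a")
      case True
      have nz: "?ia *v x \<noteq> 0" using det_1_inj[OF matrix_inv_mult(3)[OF a], of x 0] x by auto
      then have "vec.span {?ia *v x} = vec.span {x}"
        using True ea[OF x] span_singleton_sym by blast
      then have "N x (?ia *v x) = N x x" by (simp add: N_def)
      then show ?thesis using True N1[OF x] by simp
    next
      case False
      then show ?thesis using N2[OF x] ea[OF x] by simp
    qed
  qed simp
  also have "\<dots> = card (eigenvectors a) * N x0 x0 + card ({x. x \<noteq> 0} - eigenvectors a) * N x0 y0"
  proof -
    have "eigenvectors a \<subseteq> {x. x \<noteq> 0}" by (auto simp: eigenvectors_def)
    then have "{x. x \<noteq> 0} \<inter> eigenvectors a = eigenvectors a"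
      "{x. x \<noteq> 0} \<inter> - eigenvectors a = {x. x \<noteq> 0} - eigenvectors a" by auto
    then show ?thesis by (subst sum.If_cases) (auto simp: mult.commute)
  qed
  finally have "card G * m = card (eigenvectors a) * N x0 x0
    + card ({x. x \<noteq> 0} - eigenvectors a) * N x0 y0" .
  from arg_cong[OF this, of int]
  have "?G * int m = ?a * int (N x0 x0) + int (card ({x. x \<noteq> 0} - eigenvectors a)) * int (N x0 y0)"
    by (simp only: of_nat_mult of_nat_add)
  moreover have "int (card ({x. x \<noteq> 0} - eigenvectors a)) = ?Q - 1 - ?a"
  proof -
    have sub: "eigenvectors a \<subseteq> {x. x \<noteq> 0}" by (auto simp: eigenvectors_def)
    then have "card (eigenvectors a) \<le> CARD('k ^ 'n) - 1"
      unfolding cN0[symmetric] by (intro card_mono) auto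
    with sub Qgt show ?thesis
      by (subst card_Diff_subset) (auto simp: cN0 of_nat_diff)
  qed
  ultimately have e3: "?G * int m = ?a * int (N x0 x0) + (?Q - 1 - ?a) * int (N x0 y0)" by simp
  have "?G * ((?Q - 1) * (int m * (?Q - ?q)))
    = (?Q - 1) * (?Q - ?q) * (?G * int m)" by (simp add: algebra_simps)
  also have "\<dots> = ?a * (?Q - ?q) * ((?Q - 1) * int (N x0 x0))
      + (?Q - 1 - ?a) * (?Q - 1) * ((?Q - ?q) * int (N x0 y0))"
    unfolding e3 by (simp add: algebra_simps)
  also have "\<dots> = ?a * (?Q - ?q) * ((?Q - 1) * int (N x0 x0))
      + (?Q - 1 - ?a) * (?q - 1) * ((?Q - 1) * ?G - (?Q - 1) * int (N x0 x0))"
    unfolding e2 by (simp add: algebra_simps)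
  also have "\<dots> = ?G * (?a * (?Q - ?q) * ?b + (?Q - 1 - ?a) * (?q - 1) * ((?Q - 1) - ?b))"
    unfolding e1 by (simp add: algebra_simps)
  also have "\<dots> = ?G * ((?Q - 1) * ((?a - (?q - 1)) * (?b - (?q - 1)) + (?q - 1) * (?Q - ?q)))"
    by (simp add: algebra_simps)
  finally have "(?Q - 1) * (int m * (?Q - ?q)) = (?Q - 1) * ((?a - (?q - 1)) * (?b - (?q - 1)) + (?q - 1) * (?Q - ?q))"
    by (rule mult_left_cancel[THEN iffD1, rotated]) (use Gpos in linarith)
  then have "int m * (?Q - ?q) = (?a - (?q - 1)) * (?b - (?q - 1)) + (?q - 1) * (?Q - ?q)"
    by (rule mult_left_cancel[THEN iffD1, rotated]) (use Qgt in linarith)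
  then show ?thesis by (simp add: left_diff_distrib)
qed

text \<open>
  Let \<open>c\<close> be an eigenvalue and \<open>L = M - c\<close>. An eigenvector for \<open>c\<close> lies in the kernel of \<open>L\<close>, and one
  for another eigenvalue in the image. Kernel and image both contain a line, and the product of
  their sizes is \<open>Q\<close>, the size of the space; so \<open>(K - q) (I - q) \<ge> 0\<close> bounds their sum by
  \<open>Q / q + q\<close>. Equality holds when \<open>M\<close> has a hyperplane and one more line of eigenvectors.
\<close>

lemma eigenvectors_bound:
  fixes M :: "'k::{field,finite} ^ 'n::finite ^ 'n"
  assumes nonscalar: "M \<notin> range mat"
  shows "int CARD('k) * (int (card (eigenvectors M)) - (int CARD('k) - 1)) \<le> int CARD('k ^ 'n) - int CARD('k)"
proof (cases "eigenvectors M = {}")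
  case True
  define x0 :: "'k ^ 'n" where "x0 = axis undefined 1"
  then have x0: "x0 \<noteq> 0" by simp
  have "CARD('k) \<le> CARD('k ^ 'n)" using card_outside_span_singleton[OF x0] by simp
  moreover have "CARD('k) > 0" by simp
  ultimately show ?thesis using True by (simp add: mult_nonneg_nonpos order.trans[of _ 0])
next
  case False
  then obtain v c where v: "v \<noteq> 0" "M *v v = c *s v"
    by (auto simp: eigenvectors_def vec.span_singleton)
  define L where "L = M - mat c"
  have L: "L *v x = M *v x - c *s x" for x
    by (simp add: L_def matrix_vector_mult_diff_rdistrib mat_mult_vector)
  let ?K = "{x. L *v x = 0}" and ?I = "range ((*v) L)"
  have fibre: "card {x. L *v x = y} = card ?K" if y: "y \<in> ?I" for y
  proof -
    obtain z where z: "y = L *v z" using y by auto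
    have "{x. L *v x = y} = (+) z ` ?K"
    proof (intro equalityI subsetI)
      fix x assume "x \<in> {x. L *v x = y}"
      then have "x = z + (x - z)" "L *v (x - z) = 0" by (simp_all add: z vec.diff)
      then show "x \<in> (+) z ` ?K" by blast
    qed (auto simp: z vec.add)
    then show ?thesis by (simp add: card_image)
  qed
  have "CARD('k ^ 'n) = (\<Sum>y\<in>?I. card {x. L *v x = y})"
    using sum.image_gen[of UNIV "\<lambda>_. 1::nat" "(*v) L"] by simp
  also have "\<dots> = card ?I * card ?K" using fibre by simp
  finally have KI: "CARD('k ^ 'n) = card ?I * card ?K" .
  have "vec.subspace ?K" by (auto simp: vec.subspace_def vec.add vec.scale)
  moreover have "v \<in> ?K" using v by (simp add: L)
  ultimately have "vec.span {v} \<subseteq> ?K" by (intro vec.span_minimal) auto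
  then have K: "CARD('k) \<le> card ?K" using card_span_singleton[OF v(1)] card_mono[of ?K "vec.span {v}"] by simp
  have "\<exists>w\<in>?I. w \<noteq> 0"
  proof (rule ccontr)
    assume "\<not> (\<exists>w\<in>?I. w \<noteq> 0)"
    then have "L = 0" by (metis matrix_eq matrix_vector_mult_0 rangeI)
    then show False using nonscalar by (simp add: L_def)
  qed
  then obtain w where w: "w \<in> ?I" "w \<noteq> 0" by blast
  have "vec.subspace ?I" using vec.subspace_image[OF vec.subspace_UNIV] by blast
  with w have "vec.span {w} \<subseteq> ?I" by (intro vec.span_minimal) auto
  then have I: "CARD('k) \<le> card ?I" using card_span_singleton[OF w(2)] card_mono[of ?I "vec.span {w}"] by simp
  have "eigenvectors M \<subseteq> (?K - {0}) \<union> (?I - {0})"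
  proof
    fix x assume "x \<in> eigenvectors M"
    then obtain d where x: "x \<noteq> 0" "M *v x = d *s x" by (auto simp: eigenvectors_def vec.span_singleton)
    then have Lx: "L *v x = (d - c) *s x" by (simp add: L vec.scale_left_diff_distrib)
    show "x \<in> (?K - {0}) \<union> (?I - {0})"
    proof (cases "d = c")
      case True then show ?thesis using Lx x by simp
    next
      case False
      then have "inverse (d - c) * (d - c) = 1" by simp
      then have "x = L *v (inverse (d - c) *s x)"
        by (simp only: vec.scale Lx vec.scale_scale vec.scale_one)
      then show ?thesis using x by blast
    qed
  qed
  then have "card (eigenvectors M) \<le> card ((?K - {0}) \<union> (?I - {0}))" by (intro card_mono) auto
  also have "\<dots> \<le> card (?K - {0}) + card (?I - {0})" by (rule card_Un_le)
  also have "\<dots> = (card ?K - 1) + (card ?I - 1)"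
    using vec.subspace_0[OF \<open>vec.subspace ?K\<close>] vec.subspace_0[OF \<open>vec.subspace ?I\<close>] by simp
  finally have E: "card (eigenvectors M) \<le> (card ?K - 1) + (card ?I - 1)" .
  have q1: "CARD('k) > 0" by simp
  then have "int (card (eigenvectors M)) \<le> int (card ?K) + int (card ?I) - 2"
    using E K I by linarith
  then have "int CARD('k) * (int (card (eigenvectors M)) - (int CARD('k) - 1))
    \<le> int CARD('k) * (int (card ?K) + int (card ?I) - 2 - (int CARD('k) - 1))"
    by (intro mult_left_mono) auto
  moreover have "0 \<le> (int (card ?K) - int CARD('k)) * (int (card ?I) - int CARD('k))"
    using K I by (intro mult_nonneg_nonneg) auto
  ultimately show ?thesis unfolding KI by (simp add: algebra_simps)
qed

section \<open>Fixed lines and eigenspaces\<close>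

lemma lines_iff: "W \<in> lines \<longleftrightarrow> (\<exists>x. x \<noteq> 0 \<and> W = vec.span {x})"
  for W :: "('k::{field,finite} ^ 'n::finite) set"
proof
  assume "W \<in> lines"
  then have W: "vec.subspace W" "vec.dim W = 1" by (simp_all add: lines_def)
  obtain B where B: "B \<subseteq> W" "vec.independent B" "W \<subseteq> vec.span B" "card B = vec.dim W"
    using vec.basis_exists[of W] by blast
  then obtain x where x: "B = {x}" using W by (auto simp: card_1_singleton_iff)
  have "x \<noteq> 0" using B(2) x vec.dependent_zero[of B] by auto
  moreover have "W = vec.span {x}"
    using B x W(1) vec.span_minimal[of B W] by auto
  ultimately show "\<exists>x. x \<noteq> 0 \<and> W = vec.span {x}" by blast
next
  assume "\<exists>x. x \<noteq> 0 \<and> W = vec.span {x}"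
  then obtain x where x: "x \<noteq> 0" "W = vec.span {x}" by blast
  then have "vec.independent {x}" by (simp add: vec.independent_insert vec.independent_empty)
  then have "vec.dim W = 1" using x vec.dim_span_eq_card_independent[of "{x}"] by simp
  then show "W \<in> lines" using x by (simp add: lines_def)
qed

lemma eigenvector_iff_line_fixed:
  fixes M :: "'k::{field,finite} ^ 'n::finite ^ 'n"
  assumes M: "det M = 1" and x: "x \<noteq> 0"
  shows "x \<in> eigenvectors M \<longleftrightarrow> (*v) M ` vec.span {x} = vec.span {x}"
proof -
  have nz: "M *v x \<noteq> 0" using det_1_inj[OF M, of x 0] x by auto
  have im: "(*v) M ` vec.span {x} = vec.span {M *v x}" using vec.span_image[of M "{x}"] by simp
  have "M *v x \<in> vec.span {x} \<longleftrightarrow> vec.span {M *v x} = vec.span {x}"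
    using span_singleton_sym[of "M *v x" x] nz vec.span_base[of "M *v x" "{M *v x}"] by auto
  then show ?thesis using x by (simp add: eigenvectors_def im)
qed

text \<open>
  The eigenvectors are partitioned by the fixed lines, and each line has \<open>q - 1\<close> generators.
\<close>

lemma card_eigenvectors:
  fixes M :: "'k::{field,finite} ^ 'n::finite ^ 'n"
  assumes M: "det M = 1"
  shows "card (eigenvectors M) = (CARD('k) - 1) * card {W \<in> lines. (*v) M ` W = W}"
proof -
  let ?E = "eigenvectors M" and ?s = "\<lambda>x. vec.span {x}"
  have nz: "x \<noteq> 0" if "x \<in> ?E" for x using that by (simp add: eigenvectors_def)
  have im: "?s ` ?E = {W \<in> lines. (*v) M ` W = W}"
  proof (intro equalityI subsetI)
    fix W assume "W \<in> ?s ` ?E"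
    then obtain x where x: "x \<in> ?E" "W = ?s x" by blast
    then show "W \<in> {W \<in> lines. (*v) M ` W = W}"
      using nz[OF x(1)] eigenvector_iff_line_fixed[OF M nz[OF x(1)]] by (auto simp: lines_iff)
  next
    fix W assume "W \<in> {W \<in> lines. (*v) M ` W = W}"
    then obtain x where x: "x \<noteq> 0" "W = ?s x" "(*v) M ` W = W" by (auto simp: lines_iff)
    then have "x \<in> ?E" using eigenvector_iff_line_fixed[OF M x(1)] by simp
    with x(2) show "W \<in> ?s ` ?E" by blast
  qed
  have fibre: "card {x \<in> ?E. ?s x = W} = CARD('k) - 1" if W: "W \<in> ?s ` ?E" for W
  proof -
    obtain x where x: "x \<in> ?E" "W = ?s x" using W by blast
    have fx: "(*v) M ` ?s x = ?s x" using x(1) eigenvector_iff_line_fixed[OF M nz[OF x(1)]] by simp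
    have "{y \<in> ?E. ?s y = W} = ?s x - {0}"
    proof (intro equalityI subsetI)
      fix y assume y: "y \<in> {y \<in> ?E. ?s y = W}"
      then have "y \<in> ?s x" using x(2) vec.span_base[of y "{y}"] by simp
      then show "y \<in> ?s x - {0}" using y nz by blast
    next
      fix y assume y: "y \<in> ?s x - {0}"
      then have "?s y = ?s x" using span_singleton_sym[of y x] by simp
      moreover from this have "y \<in> ?E" using eigenvector_iff_line_fixed[OF M, of y] y fx by simp
      ultimately show "y \<in> {y \<in> ?E. ?s y = W}" using x by simp
    qed
    then show ?thesis using card_span_singleton[OF nz[OF x(1)]] by (simp add: vec.span_zero)
  qed
  have "card ?E = (\<Sum>W\<in>?s ` ?E. card {x \<in> ?E. ?s x = W})"
    using sum.image_gen[of ?E "\<lambda>_. 1::nat" ?s] by simp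
  also have "\<dots> = (\<Sum>W\<in>?s ` ?E. CARD('k) - 1)"
    by (rule sum.cong[OF refl], rule fibre)
  also have "\<dots> = (CARD('k) - 1) * card {W \<in> lines. (*v) M ` W = W}"
    unfolding im by (simp add: mult.commute)
  finally show ?thesis .
qed

lemma scale_in_span_imp_0:
  fixes x :: "'k::{field,finite} ^ 'n::finite"
  assumes "x \<notin> vec.span S" "c *s x \<in> vec.span S"
  shows "c = 0"
proof (rule ccontr)
  assume "c \<noteq> 0"
  then have "inverse c *s (c *s x) = x" by (simp only: vec.scale_scale) simp
  then show False using vec.span_scale[OF assms(2), of "inverse c"] assms(1) by (simp only:)
qed

lemma card_span_lin_indep:
  "lin_indep xs \<Longrightarrow> card (vec.span (set xs)) = CARD('k) ^ length xs"
  for xs :: "('k::{field,finite} ^ 'n::finite) list"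
proof (induction xs)
  case (Cons x xs)
  let ?S = "vec.span (set xs)" and ?f = "\<lambda>(c, s). c *s x + s"
  have x: "x \<notin> ?S" "lin_indep xs" using Cons.prems by (simp_all add: lin_indep_Cons)
  have im: "vec.span (set (x # xs)) = ?f ` (UNIV \<times> ?S)"
  proof (intro equalityI subsetI)
    fix y assume "y \<in> vec.span (set (x # xs))"
    then obtain c where "y - c *s x \<in> ?S" by (auto simp: vec.span_insert)
    moreover have "y = c *s x + (y - c *s x)" by simp
    ultimately show "y \<in> ?f ` (UNIV \<times> ?S)" by force
  next
    fix y assume "y \<in> ?f ` (UNIV \<times> ?S)"
    then obtain c s where y: "s \<in> ?S" "y = c *s x + s" by auto
    then have "y - c *s x \<in> ?S" by simp
    then show "y \<in> vec.span (set (x # xs))" by (auto simp: vec.span_insert)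
  qed
  have inj: "inj_on ?f (UNIV \<times> ?S)"
  proof (rule inj_onI, clarify)
    fix c s c' s' assume s: "s \<in> ?S" "s' \<in> ?S" and e: "c *s x + s = c' *s x + s'"
    have "(c - c') *s x = s' - s" using e by (simp add: vec.scale_left_diff_distrib algebra_simps)
    then have m: "(c - c') *s x \<in> ?S" using s vec.span_diff by simp
    have "c = c'" using scale_in_span_imp_0[OF x(1) m] by simp
    with e show "c = c' \<and> s = s'" by simp
  qed
  show ?case unfolding im card_image[OF inj] using Cons.IH[OF x(2)] by (simp add: card_cartesian_product)
qed simp

lemma subspace_frame:
  fixes W :: "('k::{field,finite} ^ 'n::finite) set"
  assumes "vec.subspace W"
  obtains xs where "lin_indep xs" "W = vec.span (set xs)"
proof -
  obtain B where B: "B \<subseteq> W" "vec.independent B" "W \<subseteq> vec.span B" "card B = vec.dim W"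
    using vec.basis_exists[of W] by blast
  have "finite B" by (rule vec.finiteI_independent[OF B(2)])
  then obtain xs where xs: "set xs = B" "distinct xs"
    using finite_distinct_list[of B] by blast
  have "vec.span B = W" using B assms vec.span_minimal[of B W] by auto
  then show ?thesis using that[of xs] xs B by (simp add: lin_indep_def)
qed

definition eigenspace :: "'k::{field,finite} ^ 'n::finite ^ 'n \<Rightarrow> 'k \<Rightarrow> ('k ^ 'n) set" where
  "eigenspace M c = {x. M *v x = c *s x}"

lemma subspace_eigenspace: "vec.subspace (eigenspace M c)"
  by (simp add: vec.subspace_def eigenspace_def vec.add vec.scale vec.scale_right_distrib vec.scale_left_commute)

text \<open>
  An invertible matrix has at most \<open>q - 1\<close> eigenvalues, so its eigenvectors are at most \<open>q - 1\<close> times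
  as many as those in a largest eigenspace.
\<close>

lemma largest_eigenspace:
  fixes M :: "'k::{field,finite} ^ 'n::finite ^ 'n"
  assumes M: "det M = 1" and ev: "eigenvectors M \<noteq> {}"
  obtains c xs where "lin_indep xs" "xs \<noteq> []" "vec.span (set xs) \<subseteq> eigenspace M c"
    "card (eigenvectors M) \<le> (CARD('k) - 1) * (CARD('k) ^ length xs - 1)"
proof -
  let ?\<kappa> = "\<lambda>c. card (eigenspace M c)"
  obtain c where c: "\<And>d. ?\<kappa> d \<le> ?\<kappa> c"
  proof -
    have "Max (range ?\<kappa>) \<in> range ?\<kappa>" by (rule Max_in) auto
    then obtain c where "?\<kappa> c = Max (range ?\<kappa>)" by force
    then have "?\<kappa> d \<le> ?\<kappa> c" for d by simp
    then show ?thesis using that by blast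
  qed
  obtain xs where xs: "lin_indep xs" "eigenspace M c = vec.span (set xs)"
    using subspace_frame[OF subspace_eigenspace] by blast
  have z: "0 \<in> eigenspace M d" for d using vec.subspace_0[OF subspace_eigenspace] .
  have "eigenvectors M \<subseteq> (\<Union>d\<in>- {0}. eigenspace M d - {0})"
  proof
    fix x assume "x \<in> eigenvectors M"
    then obtain d where x: "x \<noteq> 0" "M *v x = d *s x" by (auto simp: eigenvectors_def vec.span_singleton)
    have "d \<noteq> 0" using x det_1_inj[OF M, of x 0] by auto
    then show "x \<in> (\<Union>d\<in>- {0}. eigenspace M d - {0})" using x by (auto simp: eigenspace_def)
  qed
  then have "card (eigenvectors M) \<le> card (\<Union>d\<in>- {0}. eigenspace M d - {0})"
    by (intro card_mono) auto
  also have "\<dots> \<le> (\<Sum>d\<in>- {0}. card (eigenspace M d - {0}))" by (rule card_UN_le) simp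
  also have "\<dots> \<le> (\<Sum>d\<in>- {0 :: 'k}. ?\<kappa> c - 1)"
    using c z by (intro sum_mono) (simp add: diff_le_mono)
  also have "\<dots> = (CARD('k) - 1) * (CARD('k) ^ length xs - 1)"
    by (simp add: xs card_span_lin_indep Compl_eq_Diff_UNIV)
  finally have E: "card (eigenvectors M) \<le> (CARD('k) - 1) * (CARD('k) ^ length xs - 1)" .
  moreover have "card (eigenvectors M) > 0" using ev by (simp add: card_gt_0_iff)
  then have "xs \<noteq> []" using E by (cases xs) auto
  ultimately show ?thesis using that[of xs c] xs by simp
qed

text \<open>
  Conjugate \<open>b\<close> so that its eigenspace spanned by \<open>us\<close> moves into the eigenspace of \<open>a\<close> spanned by
  \<open>xs\<close>; there both factors act as scalars.
\<close>

lemma eigenspaces_aligned: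
  fixes a b :: "'k::{field,finite} ^ 'n::finite ^ 'n"
  assumes us: "lin_indep us" "vec.span (set us) \<subseteq> eigenspace b c"
    and xs: "lin_indep xs" "vec.span (set xs) \<subseteq> eigenspace a d" and len: "length us \<le> length xs"
  obtains g where "det g = 1" "CARD('k) ^ length us - 1 \<le> card (eigenvectors (a ** conj_by g b))"
proof -
  let ?ys = "take (length us) xs"
  have "lin_indep ?ys"
    using xs(1) vec.independent_mono[of "set xs" "set ?ys"] by (simp add: lin_indep_def set_take_subset)
  then obtain g :: "'k ^ 'n ^ 'n"
    where g: "det g = 1" "\<And>i. i < length us \<Longrightarrow> g *v (us ! i) \<in> vec.span {?ys ! i}"
    using SL_transitive_on_frames[OF us(1), of ?ys] len by auto
  have "(*v) g ` set us \<subseteq> vec.span (set xs)"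
  proof
    fix y assume "y \<in> (*v) g ` set us"
    then obtain i where i: "i < length us" "y = g *v (us ! i)" by (auto simp: in_set_conv_nth)
    then have "y \<in> vec.span {xs ! i}" using g(2)[OF i(1)] by simp
    moreover have "vec.span {xs ! i} \<subseteq> vec.span (set xs)" using i len by (intro vec.span_mono) auto
    ultimately show "y \<in> vec.span (set xs)" by blast
  qed
  then have sub: "vec.span ((*v) g ` set us) \<subseteq> vec.span (set xs)"
    by (intro vec.span_minimal) simp_all
  have "(*v) g ` (vec.span (set us) - {0}) \<subseteq> eigenvectors (a ** conj_by g b)"
  proof
    fix y assume "y \<in> (*v) g ` (vec.span (set us) - {0})"
    then obtain x where x: "x \<in> vec.span (set us)" "x \<noteq> 0" "y = g *v x" by blast
    have bx: "b *v x = c *s x" using x(1) us(2) by (auto simp: eigenspace_def)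
    have "y \<in> vec.span (set xs)" using matrix_vector_span[OF x(1), of g] sub x(3) by blast
    then have ay: "a *v y = d *s y" using xs(2) by (auto simp: eigenspace_def)
    have "(a ** conj_by g b) *v y = a *v (g *v (b *v x))"
      by (simp add: x(3) conj_by_apply[OF g(1)] flip: matrix_vector_mul_assoc)
    also have "\<dots> = c *s (d *s y)" by (simp only: bx vec.scale x(3)[symmetric] ay)
    finally have "(a ** conj_by g b) *v y \<in> vec.span {y}" by (simp add: vec.span_scale vec.span_base)
    moreover have "y \<noteq> 0" using det_1_inj[OF g(1), of x 0] x by simp
    ultimately show "y \<in> eigenvectors (a ** conj_by g b)" by (simp add: eigenvectors_def)
  qed
  then have "card ((*v) g ` (vec.span (set us) - {0})) \<le> card (eigenvectors (a ** conj_by g b))"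
    by (intro card_mono) auto
  moreover have "card ((*v) g ` (vec.span (set us) - {0})) = CARD('k) ^ length us - 1"
    using det_1_inj[OF g(1)] card_span_lin_indep[OF us(1)]
    by (subst card_image) (auto intro!: inj_onI simp: vec.span_zero)
  ultimately show ?thesis using that[OF g(1)] by simp
qed

section \<open>A constant number of fixed lines is one\<close>

lemma card_eigenvectors_commute:
  fixes M N :: "'k::{field,finite} ^ 'n::finite ^ 'n"
  assumes "det M = 1"
  shows "card (eigenvectors (M ** N)) = card (eigenvectors (N ** M))"
proof -
  have "conj_by M (N ** M) = M ** N ** (M ** matrix_inv M)"
    by (simp only: conj_by_def matrix_mul_assoc)
  then have "conj_by M (N ** M) = M ** N" using matrix_inv_mult(2)[OF assms] by simp
  then show ?thesis using card_eigenvectors_conj_by[OF assms, of "N ** M"] by simp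
qed

text \<open>
  The two products are conjugate; this makes the roles of \<open>a\<close> and \<open>b\<close> interchangeable.
\<close>

lemma card_eigenvectors_swap:
  fixes a b :: "'k::{field,finite} ^ 'n::finite ^ 'n"
  assumes b: "det b = 1" and g: "det g = 1"
  shows "card (eigenvectors (b ** conj_by g a)) = card (eigenvectors (a ** conj_by (matrix_inv g) b))"
proof -
  note i = matrix_inv_mult[OF g]
  have "conj_by g (a ** conj_by (matrix_inv g) b) = conj_by g a ** b"
    using conj_by_mult[OF g i(3), of b] i(2) by (simp add: conj_by_matrix_mult[OF g])
  then show ?thesis
    using card_eigenvectors_conj_by[OF g, of "a ** conj_by (matrix_inv g) b"]
      card_eigenvectors_commute[OF b] by simp
qed

lemma nonscalar_dimension:
  fixes M :: "'k::{field,finite} ^ 'n::finite ^ 'n"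
  assumes "M \<notin> range mat" shows "CARD('n) \<ge> 2"
proof (rule ccontr)
  assume "\<not> CARD('n) \<ge> 2"
  moreover have "CARD('n) > 0" by simp
  ultimately have "CARD('n) = 1" by linarith
  then obtain i :: 'n where U: "UNIV = {i}" by (auto simp: card_1_singleton_iff)
  have "M $ r $ c = mat (M $ i $ i) $ r $ c" for r c
  proof -
    have "r = i" "c = i" using U by blast+
    then show ?thesis by (simp add: mat_def)
  qed
  then have "M = mat (M $ i $ i)" unfolding vec_eq_iff by blast
  then show False using assms by blast
qed

text \<open>
  Here and in \<open>fixed_line_arith_size\<close>, \<open>D\<close> is \<open>Q - q = (q - 1) (N - 1)\<close>, the equation is the averaging
  identity, and the upper bounds come from \<open>eigenvectors_bound\<close>. If a factor had no fixed line, the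
  sign or the size of the right-hand side would be impossible.
\<close>

lemma fixed_line_arith_sign:
  fixes q D fa fb fm :: int
  assumes q: "q \<ge> 2" and D: "D \<ge> q * (q - 1)" and f: "fa \<ge> 0" "fb \<ge> 0" "fm \<ge> 0"
    and eq: "(fm - 1) * D = (q - 1) * (fa - 1) * (fb - 1)"
    and ba: "q * (q - 1) * (fa - 1) \<le> D" and bb: "q * (q - 1) * (fb - 1) \<le> D"
    and fm: "fm \<noteq> 1"
  shows "fa \<ge> 2 \<and> fb \<ge> 2 \<and> fm \<ge> 2"
proof -
  have qD: "q - 1 < D" "D > 0"
  proof -
    have "2 * (q - 1) \<le> q * (q - 1)" using q by (intro mult_right_mono) auto
    from this D have "2 * (q - 1) \<le> D" by (rule order.trans)
    then show "q - 1 < D" using q by simp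
    then show "D > 0" using q by linarith
  qed
  have ne: "fa \<noteq> 1" "fb \<noteq> 1" using eq fm qD by auto
  have key: False if 0: "x = 0" "y \<ge> 0" "y \<noteq> 1" and e: "(fm - 1) * D = (q - 1) * (x - 1) * (y - 1)"
    and b: "q * (q - 1) * (y - 1) \<le> D" for x y :: int
  proof (cases "y = 0")
    case True
    then have e': "(fm - 1) * D = q - 1" using e 0 by simp
    then have "(fm - 1) * D > 0" using q by simp
    then have "fm - 1 > 0" using qD by (simp add: zero_less_mult_iff)
    then have "1 * D \<le> (fm - 1) * D" using qD by (intro mult_right_mono) auto
    then show False using e' qD by simp
  next
    case False
    then have y: "y \<ge> 2" using 0 by linarith
    have e': "(1 - fm) * D = (q - 1) * (y - 1)" using e 0 by (simp add: algebra_simps)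
    moreover have "(q - 1) * (y - 1) > 0" using q y by simp
    ultimately have "(1 - fm) * D > 0" by simp
    then have "1 - fm > 0" using qD by (simp add: zero_less_mult_iff)
    then have "fm = 0" using f by linarith
    then have "D = (q - 1) * (y - 1)" using e' by simp
    then have "q * D \<le> D" using b by (simp add: mult.assoc)
    moreover have "2 * D \<le> q * D" using q qD by (intro mult_right_mono) auto
    ultimately show False using qD by linarith
  qed
  have eq': "(fm - 1) * D = (q - 1) * (fb - 1) * (fa - 1)" using eq by (simp add: algebra_simps)
  have "fa \<noteq> 0" using key[of fa fb] eq bb f ne by blast
  moreover have "fb \<noteq> 0" using key[of fb fa] eq' ba f ne by blast
  ultimately have ab: "fa \<ge> 2" "fb \<ge> 2" using f ne by linarith+
  then have "(q - 1) * (fa - 1) * (fb - 1) > 0" using q by simp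
  then have "(fm - 1) * D > 0" using eq by simp
  then have "fm - 1 > 0" using qD by (simp add: zero_less_mult_iff)
  then show ?thesis using ab by simp
qed

text \<open>
  The equation and the bound on \<open>fa\<close> give \<open>q (fm - 1) \<le> fb - 1\<close>. But \<open>fb\<close> is at most \<open>q - 1\<close> times the
  number of lines of a \<open>k\<close>-dimensional eigenspace, and \<open>fm\<close> is at least that number. The case \<open>k = 1\<close>
  is separate: there the lower bound on \<open>fm\<close> is vacuous and \<open>fm \<ge> 2\<close> is used instead.
\<close>

lemma fixed_line_arith_size:
  fixes q D fa fb fm :: int and k :: nat
  assumes q: "q \<ge> 2" and D: "D > 0" and f: "fa \<ge> 2" "fb \<ge> 2" "fm \<ge> 2"
    and eq: "(fm - 1) * D = (q - 1) * (fa - 1) * (fb - 1)"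
    and ba: "q * (q - 1) * (fa - 1) \<le> D"
    and k: "k > 0" and fb: "fb \<le> q ^ k - 1" and fm: "q ^ k - 1 \<le> (q - 1) * fm"
  shows False
proof -
  have "q * (fm - 1) * D = q * ((fm - 1) * D)" by simp
  also have "\<dots> = (q * (q - 1) * (fa - 1)) * (fb - 1)" unfolding eq by (simp add: mult.assoc)
  also have "\<dots> \<le> D * (fb - 1)" using ba f by (intro mult_right_mono) auto
  finally have "D * (q * (fm - 1)) \<le> D * (fb - 1)" by (simp add: algebra_simps)
  then have le: "q * (fm - 1) \<le> q ^ k - 2" using D fb by simp
  show False
  proof (cases "k = 1")
    case True
    moreover have "q * 1 \<le> q * (fm - 1)" using q f by (intro mult_left_mono) auto
    ultimately show False using le by simp
  next
    case False
    then have "q ^ 2 \<le> q ^ k" using k q by (intro power_increasing) auto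
    moreover have "q * (q ^ k - 1) \<le> q * ((q - 1) * fm)" using fm q by (intro mult_left_mono) auto
    moreover have "(q - 1) * (q * (fm - 1)) \<le> (q - 1) * (q ^ k - 2)" using le q by (intro mult_left_mono) auto
    ultimately show False using q by (simp add: algebra_simps power2_eq_square)
  qed
qed

lemma constant_fixed_lines_eq_1:
  fixes a b :: "'k::{field,finite} ^ 'n::finite ^ 'n"
  assumes a: "det a = 1" "a \<notin> range mat" and b: "det b = 1" "b \<notin> range mat"
    and m: "\<And>g. det g = 1 \<Longrightarrow> card (eigenvectors (a ** conj_by g b)) = m"
  shows "m = CARD('k) - 1 \<and> (card (eigenvectors a) = CARD('k) - 1 \<or> card (eigenvectors b) = CARD('k) - 1)"
proof -
  let ?f = "\<lambda>M :: 'k ^ 'n ^ 'n. card {W \<in> lines. (*v) M ` W = W}"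
  define q where "q = int CARD('k)"
  define D where "D = int CARD('k ^ 'n) - q"
  define fa fb fm where f_def: "fa = int (?f a)" "fb = int (?f b)" "fm = int (?f (a ** b))"
  have q: "q \<ge> 2" using CARD_gt_1[where 'k = 'k] by (simp add: q_def)
  have cq: "int (CARD('k) - 1) = q - 1" using q by (simp add: q_def of_nat_diff)
  have E: "int (card (eigenvectors a)) = (q - 1) * fa" "int (card (eigenvectors b)) = (q - 1) * fb"
    using card_eigenvectors[OF a(1)] card_eigenvectors[OF b(1)] cq by (simp_all add: f_def)
  have "det (a ** b) = 1" using a b by (simp add: det_mul)
  then have "m = (CARD('k) - 1) * ?f (a ** b)"
    using m[of "mat 1"] card_eigenvectors[of "a ** b"] by simp
  then have mE: "int m = (q - 1) * fm" by (simp only: of_nat_mult cq f_def)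
  have nn: "fa \<ge> 0" "fb \<ge> 0" "fm \<ge> 0" by (simp_all add: f_def)
  have "q ^ 2 \<le> q ^ CARD('n)" using q nonscalar_dimension[OF a(2)] by (intro power_increasing) auto
  then have D: "D \<ge> q * (q - 1)" by (simp add: D_def q_def power2_eq_square algebra_simps)
  moreover have "q * (q - 1) > 0" using q by simp
  ultimately have Dpos: "D > 0" by linarith
  have avg: "(q - 1) * ((fm - 1) * D) = (q - 1) * ((q - 1) * (fa - 1) * (fb - 1))"
    using conj_average[OF a(1) b(1) nonscalar_dimension[OF a(2)] m]
    unfolding E mE q_def[symmetric] D_def[symmetric] by (simp add: algebra_simps)
  have eq: "(fm - 1) * D = (q - 1) * (fa - 1) * (fb - 1)"
    by (rule mult_left_cancel[THEN iffD1, OF _ avg]) (use q in linarith)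
  have ba: "q * (q - 1) * (fa - 1) \<le> D"
    using eigenvectors_bound[OF a(2)] unfolding E q_def[symmetric] D_def[symmetric]
    by (simp add: algebra_simps)
  have bb: "q * (q - 1) * (fb - 1) \<le> D"
    using eigenvectors_bound[OF b(2)] unfolding E q_def[symmetric] D_def[symmetric]
    by (simp add: algebra_simps)
  have "fm = 1"
  proof (rule ccontr)
    assume "fm \<noteq> 1"
    then have f2: "fa \<ge> 2" "fb \<ge> 2" "fm \<ge> 2"
      using fixed_line_arith_sign[OF q D nn eq ba bb] by auto
    have "(q - 1) * fa \<noteq> 0" "(q - 1) * fb \<noteq> 0" using f2 q by auto
    then have nea: "eigenvectors a \<noteq> {}" and neb: "eigenvectors b \<noteq> {}" using E by auto
    obtain ca xs where xs: "lin_indep xs" "xs \<noteq> []" "vec.span (set xs) \<subseteq> eigenspace a ca"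
      "card (eigenvectors a) \<le> (CARD('k) - 1) * (CARD('k) ^ length xs - 1)"
      by (rule largest_eigenspace[OF a(1) nea])
    obtain cb us where us: "lin_indep us" "us \<noteq> []" "vec.span (set us) \<subseteq> eigenspace b cb"
      "card (eigenvectors b) \<le> (CARD('k) - 1) * (CARD('k) ^ length us - 1)"
      by (rule largest_eigenspace[OF b(1) neb])
    have pk: "int (CARD('k) ^ k - 1) = q ^ k - 1" for k
      by (simp add: q_def of_nat_diff)
    have up: "f \<le> q ^ k - 1" if "int e = (q - 1) * f" "e \<le> (CARD('k) - 1) * (CARD('k) ^ k - 1)" for e f k
    proof -
      have "int e \<le> int ((CARD('k) - 1) * (CARD('k) ^ k - 1))" using that(2) by (simp only: of_nat_le_iff)
      then have "(q - 1) * f \<le> (q - 1) * (q ^ k - 1)" unfolding that(1) of_nat_mult cq pk .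
      then show ?thesis using q by (simp add: mult_le_cancel_left)
    qed
    have low: "q ^ k - 1 \<le> (q - 1) * fm" if "CARD('k) ^ k - 1 \<le> m" for k
      using that pk[of k] mE by linarith
    show False
    proof (cases "length us \<le> length xs")
      case True
      obtain g where "det g = 1" "CARD('k) ^ length us - 1 \<le> card (eigenvectors (a ** conj_by g b))"
        by (rule eigenspaces_aligned[OF us(1,3) xs(1,3) True])
      then have "q ^ length us - 1 \<le> (q - 1) * fm" using low m by simp
      then show False
        using fixed_line_arith_size[OF q Dpos f2 eq ba _ up[OF E(2) us(4)]] us(2) by simp
    next
      case False
      then have "length xs \<le> length us" by simp
      then obtain g where g: "det g = 1" "CARD('k) ^ length xs - 1 \<le> card (eigenvectors (b ** conj_by g a))"
        by (rule eigenspaces_aligned[OF xs(1,3) us(1,3)])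
      then have "q ^ length xs - 1 \<le> (q - 1) * fm"
        using low m[OF matrix_inv_mult(3)[OF g(1)]] card_eigenvectors_swap[OF b(1) g(1), of a] by simp
      moreover have "(fm - 1) * D = (q - 1) * (fb - 1) * (fa - 1)" using eq by (simp add: algebra_simps)
      ultimately show False
        using fixed_line_arith_size[OF q Dpos f2(2,1,3) _ bb _ up[OF E(1) xs(4)]] xs(2) by simp
    qed
  qed
  then have "(q - 1) * (fa - 1) * (fb - 1) = 0" using eq by simp
  then have "fa = 1 \<or> fb = 1" using q by auto
  moreover have "int m = int (CARD('k) - 1)" using mE \<open>fm = 1\<close> cq by simp
  ultimately show ?thesis using E cq by (metis mult.right_neutral of_nat_eq_iff)
qed

section \<open>Patterns in the action of a single matrix\<close>

lemma in_span_pair: "x \<in> vec.span {u, w} \<longleftrightarrow> (\<exists>p r. x = p *s u + r *s w)"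
  for x :: "'k::{field,finite} ^ 'n::finite"
proof
  assume "x \<in> vec.span {u, w}"
  then obtain p where "x - p *s u \<in> vec.span {w}" by (auto simp: vec.span_insert)
  then obtain r where "x - p *s u = r *s w" by (auto simp: vec.span_singleton)
  then have "x = p *s u + r *s w" by (metis add.commute diff_add_cancel)
  then show "\<exists>p r. x = p *s u + r *s w" by blast
next
  assume "\<exists>p r. x = p *s u + r *s w"
  then obtain p r where "x = p *s u + r *s w" by blast
  then show "x \<in> vec.span {u, w}" by (simp add: vec.span_add vec.span_scale vec.span_base)
qed

lemma eq_if_diff_eq: "a = b \<Longrightarrow> x - y = a - b \<Longrightarrow> x = y" for a :: "'a::group_add"
  by simp

lemma in_span_single: "x \<in> vec.span {w} \<longleftrightarrow> (\<exists>r. x = r *s w)"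
  for x :: "'k::{field,finite} ^ 'n::finite"
  by (auto simp: vec.span_singleton)

lemma in_span_singleI: "x = c *s w \<Longrightarrow> x \<in> vec.span {w}"
  for x :: "'k::{field,finite} ^ 'n::finite"
  by (simp add: vec.span_scale vec.span_base)

lemma comb_in_span_pair: "p *s u + r *s w \<in> vec.span {u, w}"
  for u :: "'k::{field,finite} ^ 'n::finite"
  using in_span_pair by blast

lemma in_span_pairI: "x = p *s u + r *s w \<Longrightarrow> x \<in> vec.span {u, w}"
  for x :: "'k::{field,finite} ^ 'n::finite"
  using in_span_pair by blast

text \<open>
  If all vectors are eigenvectors, the standard basis shows that \<open>M\<close> is diagonal, and the sums of two
  basis vectors show that the diagonal entries agree.
\<close>

lemma nonscalar_noneigenvector:
  fixes M :: "'k::{field,finite} ^ 'n::finite ^ 'n"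
  assumes "M \<notin> range mat"
  obtains u where "M *v u \<notin> vec.span {u}"
proof -
  have False if all: "\<And>u. M *v u \<in> vec.span {u}"
  proof -
    define e :: "'n \<Rightarrow> 'k ^ 'n" where "e = (\<lambda>j. axis j 1)"
    have col: "(M *v e j) $ i = M $ i $ j" for i j by (simp add: e_def matrix_vector_axis)
    have off: "M $ i $ j = 0" if "i \<noteq> j" for i j
    proof -
      obtain c where "M *v e j = c *s e j" using all[of "e j"] by (auto simp: in_span_single)
      then show ?thesis using col[of j i] that by (simp add: e_def axis_def)
    qed
    have diag: "M $ i $ i = M $ j $ j" for i j
    proof (cases "i = j")
      case False
      obtain c where c: "M *v (e i + e j) = c *s (e i + e j)"
        using all[of "e i + e j"] by (auto simp: in_span_single)
      have "M $ k $ i + M $ k $ j = c * (e i $ k + e j $ k)" for k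
        using arg_cong[OF c, of "\<lambda>x. x $ k"] by (simp add: vec.add col distrib_left)
      from this[of i] this[of j] show ?thesis using off[OF False] off[of j i] False
        by (simp add: e_def axis_def)
    qed simp
    have "M $ i $ j = mat (M $ k $ k) $ i $ j" for i j k
      using off[of i j] diag[of i k] by (cases "i = j") (simp_all add: mat_def)
    then have "M = mat (M $ k $ k)" for k unfolding vec_eq_iff by blast
    then show False using assms by blast
  qed
  then show ?thesis using that by blast
qed

lemma exists_outside_span:
  fixes S :: "('k::{field,finite} ^ 'n::finite) set"
  assumes "finite S" "card S < CARD('n)"
  obtains t where "t \<notin> vec.span S"
proof -
  have "vec.span S \<noteq> UNIV"
    using vec.dim_le_card[of UNIV S] assms by (auto simp: vec_dim_card simp del: vec.dim_UNIV)
  then show ?thesis using that by blast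
qed

text \<open>
  The independence says that \<open>M\<close> does not act as a scalar on the quotient by the line of \<open>w\<close>. If
  \<open>w0\<close> itself does not have this property, \<open>M\<close> acts on the quotient by \<open>w0\<close> as a scalar \<open>\<alpha>\<close>. Then
  \<open>M - \<alpha>\<close> has rank one with image the line of \<open>w0\<close>, and any \<open>w\<close> in its kernel, but off that line,
  will do; the proof finds such a vector \<open>s\<close>.
\<close>

lemma eigenvector_and_nonscalar_quotient:
  fixes M :: "'k::{field,finite} ^ 'n::finite ^ 'n"
  assumes n: "CARD('n) \<ge> 3" and M: "M \<notin> range mat" and w0: "w0 \<in> eigenvectors M"
  obtains w u where "w \<in> eigenvectors M" "lin_indep [M *v u, u, w]"
proof -
  note result = that
  have w0n: "w0 \<noteq> 0" and "M *v w0 \<in> vec.span {w0}" using w0 by (simp_all add: eigenvectors_def)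
  obtain u where u: "M *v u \<notin> vec.span {u}" using nonscalar_noneigenvector[OF M] .
  have uw: "u \<notin> vec.span {w0}"
  proof
    assume h: "u \<in> vec.span {w0}"
    have "u \<noteq> 0" using u vec.span_zero by auto
    then have "vec.span {w0} = vec.span {u}" using h span_singleton_sym[of u w0] by simp
    then show False using u matrix_maps_line_cong[of w0 u M w0] \<open>M *v w0 \<in> vec.span {w0}\<close> by simp
  qed
  have found: ?thesis if y: "M *v y \<notin> vec.span {y, w0}" "y \<notin> vec.span {w0}" for y
    by (rule result[of w0 y]) (use y w0 w0n in \<open>simp_all add: lin_indep_Cons\<close>)
  show ?thesis
  proof (cases "M *v u \<in> vec.span {u, w0}")
    case False
    then show ?thesis using found uw by blast
  next
    case True
    then obtain \<alpha> \<beta> where Mu: "M *v u = \<alpha> *s u + \<beta> *s w0" by (auto simp: in_span_pair)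
    have \<beta>: "\<beta> \<noteq> 0" using u Mu by (auto simp: in_span_single)
    have "card {u, w0} \<le> 2" by (simp add: card_insert_if)
    then obtain t where t: "t \<notin> vec.span {u, w0}"
      using exists_outside_span[of "{u, w0}"] n by auto
    have tw: "t \<notin> vec.span {w0}" using t vec.span_mono[of "{w0}" "{u, w0}"] by auto
    have tuw: "t + u \<notin> vec.span {w0}"
    proof
      assume "t + u \<in> vec.span {w0}"
      then obtain r where "t + u = r *s w0" by (auto simp: in_span_single)
      then have "t = (- 1) *s u + r *s w0" by (simp add: eq_diff_eq)
      then show False using t comb_in_span_pair by metis
    qed
    show ?thesis
    proof (cases "M *v t \<in> vec.span {t, w0} \<and> M *v (t + u) \<in> vec.span {t + u, w0}")
      case False
      then show ?thesis using found tw tuw by blast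
    next
      case True
      then obtain \<gamma> \<delta> \<epsilon> \<zeta> where Mt: "M *v t = \<gamma> *s t + \<delta> *s w0"
        and Mtu: "M *v (t + u) = \<epsilon> *s (t + u) + \<zeta> *s w0" by (auto simp: in_span_pair)
      have eq: "(\<gamma> - \<epsilon>) *s t = (\<epsilon> - \<alpha>) *s u + (\<zeta> - \<delta> - \<beta>) *s w0"
      proof (rule eq_if_diff_eq)
        show "\<gamma> *s t + \<delta> *s w0 + (\<alpha> *s u + \<beta> *s w0) = \<epsilon> *s (t + u) + \<zeta> *s w0"
          using Mtu by (simp only: vec.add Mt Mu)
      qed (simp add: vec_eq_iff algebra_simps)
      then have "\<gamma> - \<epsilon> = 0" using scale_in_span_imp_0[OF t] comb_in_span_pair by metis
      then have "(\<epsilon> - \<alpha>) *s u + (\<zeta> - \<delta> - \<beta>) *s w0 = 0" unfolding eq[symmetric] by simp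
      then have "(\<epsilon> - \<alpha>) *s u = (\<delta> + \<beta> - \<zeta>) *s w0"
        by (rule eq_if_diff_eq) (simp add: vec_eq_iff algebra_simps)
      then have "(\<epsilon> - \<alpha>) *s u \<in> vec.span {w0}" by (rule in_span_singleI)
      then have "\<epsilon> - \<alpha> = 0" by (rule scale_in_span_imp_0[OF uw])
      with \<open>\<gamma> - \<epsilon> = 0\<close> have \<gamma>: "\<gamma> = \<alpha>" by simp
      define s where "s = t - (\<delta> / \<beta>) *s u"
      have ts: "t = s + (\<delta> / \<beta>) *s u" by (simp add: s_def)
      have "M *v s = M *v t - (\<delta> / \<beta>) *s (M *v u)" by (simp add: s_def vec.diff vec.scale)
      also have "\<dots> = \<alpha> *s s"
        using \<beta> by (simp add: Mt Mu \<gamma> s_def vec_eq_iff field_simps)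
      finally have Ms: "M *v s = \<alpha> *s s" .
      have "s \<noteq> 0"
      proof
        assume "s = 0"
        then have "t = (\<delta> / \<beta>) *s u + 0 *s w0" using ts by simp
        then show False using t comb_in_span_pair by metis
      qed
      then have s: "s \<in> eigenvectors M" using Ms by (auto simp: eigenvectors_def in_span_single)
      have su: "s \<notin> vec.span {u, w0}"
      proof
        assume "s \<in> vec.span {u, w0}"
        then have "s + (\<delta> / \<beta>) *s u \<in> vec.span {u, w0}"
          by (simp add: vec.span_add vec.span_scale vec.span_base)
        then show False using t ts by simp
      qed
      have us: "u \<notin> vec.span {s}"
      proof
        assume "u \<in> vec.span {s}"
        moreover have "u \<noteq> 0" using uw vec.span_zero by auto
        ultimately have "s \<in> vec.span {u}" using span_singleton_commute \<open>s \<noteq> 0\<close> by blast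
        then show False using su vec.span_mono[of "{u}" "{u, w0}"] by auto
      qed
      have "M *v u \<notin> vec.span {u, s}"
      proof
        assume "M *v u \<in> vec.span {u, s}"
        then obtain p r where pr: "M *v u = p *s u + r *s s" by (auto simp: in_span_pair)
        have "r *s s = (\<alpha> - p) *s u + \<beta> *s w0"
          by (rule eq_if_diff_eq[OF pr[symmetric, unfolded Mu]]) (simp add: vec_eq_iff algebra_simps)
        then have "r = 0" using scale_in_span_imp_0[OF su] comb_in_span_pair by metis
        then have "M *v u \<in> vec.span {u}" using pr by (auto simp: in_span_single)
        then show False using u by simp
      qed
      then show ?thesis using s us \<open>s \<noteq> 0\<close> by (intro result[of s u]) (simp_all add: lin_indep_Cons)
    qed
  qed
qed

text \<open>
  Choose \<open>x\<close> such that \<open>x\<close> and its image \<open>y\<close> are independent modulo the eigenline of \<open>w\<close>. If \<open>x\<close> fails,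
  \<open>x\<close> and \<open>y\<close> span an invariant plane that misses the only eigenline. On it \<open>M\<close> has an irreducible
  characteristic polynomial, which is therefore coprime to that of \<open>w\<close>, and \<open>x + w\<close> does the job.
  The proof spells this out: a linear relation for \<open>x + w\<close> makes the eigenvalue \<open>\<mu>\<close> of \<open>w\<close> a root of
  that polynomial, and \<open>e\<close> an eigenvector in the plane.
\<close>

lemma cyclic_vector_of_degree_3:
  fixes M :: "'k::{field,finite} ^ 'n::finite ^ 'n"
  assumes n: "CARD('n) \<ge> 3" and M: "M \<notin> range mat"
    and v: "v \<in> eigenvectors M" and uniq: "eigenvectors M \<subseteq> vec.span {v}"
  obtains x where "lin_indep [M *v (M *v x), M *v x, x]"
proof -
  obtain w x where w: "w \<in> eigenvectors M" and ind: "lin_indep [M *v x, x, w]"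
    using eigenvector_and_nonscalar_quotient[OF n M v] .
  have wn: "w \<noteq> 0" using w by (simp add: eigenvectors_def)
  obtain \<mu> where Mw: "M *v w = \<mu> *s w" using w by (auto simp: eigenvectors_def in_span_single)
  have "w \<in> vec.span {v}" using w uniq by blast
  then have uniq_w: "eigenvectors M \<subseteq> vec.span {w}"
    using uniq span_singleton_sym[OF _ wn, of v] by simp
  have xw: "x \<notin> vec.span {w}" and yxw: "M *v x \<notin> vec.span {x, w}"
    using ind by (simp_all add: lin_indep_Cons)
  have yx: "M *v x \<notin> vec.span {x}" using yxw vec.span_mono[of "{x}" "{x, w}"] by auto
  have xn: "x \<noteq> 0" using xw vec.span_zero by auto
  define y where "y = M *v x"
  have yxw': "y \<notin> vec.span {x, w}" using yxw by (simp add: y_def)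
  show ?thesis
  proof (cases "M *v y \<in> vec.span {y, x}")
    case False
    then show ?thesis using that[of x] yx xn by (simp add: lin_indep_Cons y_def)
  next
    case True
    then obtain \<beta> \<alpha> where My: "M *v y = \<beta> *s y + \<alpha> *s x" by (auto simp: in_span_pair)
    have MX: "M *v (x + w) = y + \<mu> *s w" by (simp add: vec.add Mw y_def)
    have MMX: "M *v (y + \<mu> *s w) = \<beta> *s y + \<alpha> *s x + (\<mu> * \<mu>) *s w"
      by (simp add: vec.add vec.scale Mw My)
    have 1: "x + w \<noteq> 0"
    proof
      assume "x + w = 0"
      then have "x = (- 1) *s w" by (simp add: eq_neg_iff_add_eq_0)
      then have "x \<in> vec.span {w}" by (rule in_span_singleI)
      then show False using xw by blast
    qed
    have 2: "y + \<mu> *s w \<notin> vec.span {x + w}"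
    proof
      assume "y + \<mu> *s w \<in> vec.span {x + w}"
      then obtain c where "y + \<mu> *s w = c *s (x + w)" by (auto simp: in_span_single)
      then have "y = c *s x + (c - \<mu>) *s w"
        by (rule eq_if_diff_eq) (simp add: vec_eq_iff algebra_simps)
      then have "y \<in> vec.span {x, w}" by (rule in_span_pairI)
      then show False using yxw' by simp
    qed
    have 3: "M *v (y + \<mu> *s w) \<notin> vec.span {y + \<mu> *s w, x + w}"
    proof
      assume "M *v (y + \<mu> *s w) \<in> vec.span {y + \<mu> *s w, x + w}"
      then obtain p r where "\<beta> *s y + \<alpha> *s x + (\<mu> * \<mu>) *s w = p *s (y + \<mu> *s w) + r *s (x + w)"
        by (auto simp: in_span_pair MMX)
      then have e1: "(\<beta> - p) *s y = (r - \<alpha>) *s x + (p * \<mu> + r - \<mu> * \<mu>) *s w"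
        by (rule eq_if_diff_eq) (simp add: vec_eq_iff algebra_simps)
      then have "(\<beta> - p) *s y \<in> vec.span {x, w}" by (rule in_span_pairI)
      then have "\<beta> - p = 0" by (rule scale_in_span_imp_0[OF yxw'])
      then have p: "p = \<beta>" by simp
      have "(r - \<alpha>) *s x + (p * \<mu> + r - \<mu> * \<mu>) *s w = 0" unfolding e1[symmetric] by (simp add: p)
      then have "(r - \<alpha>) *s x = (\<mu> * \<mu> - \<beta> * \<mu> - r) *s w"
        unfolding p by (rule eq_if_diff_eq) (simp add: vec_eq_iff algebra_simps)
      then have "(r - \<alpha>) *s x \<in> vec.span {w}" by (rule in_span_singleI)
      then have "r - \<alpha> = 0" by (rule scale_in_span_imp_0[OF xw])
      then have r: "r = \<alpha>" by simp
      have "(\<beta> * \<mu> + \<alpha> - \<mu> * \<mu>) *s w = 0"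
        by (rule eq_if_diff_eq[OF e1[symmetric]]) (simp add: p r)
      then have "\<beta> * \<mu> + \<alpha> - \<mu> * \<mu> = 0" using vec.scale_eq_0_iff wn by blast
      then have \<mu>: "\<alpha> = \<mu> * \<mu> - \<beta> * \<mu>" by (rule eq_if_diff_eq) simp
      define e where "e = y - (\<beta> - \<mu>) *s x"
      have "M *v e = M *v y - (\<beta> - \<mu>) *s y" by (simp add: e_def vec.diff vec.scale y_def)
      also have "\<dots> = \<mu> *s e" by (simp add: My e_def \<mu> vec_eq_iff algebra_simps)
      finally have "M *v e = \<mu> *s e" .
      moreover have "e \<noteq> 0"
      proof
        assume "e = 0"
        then have "M *v x = (\<beta> - \<mu>) *s x" by (simp add: e_def y_def)
        then have "M *v x \<in> vec.span {x}" by (rule in_span_singleI)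
        then show False using yx by simp
      qed
      ultimately have "e \<in> vec.span {w}" using uniq_w by (auto simp: eigenvectors_def in_span_single)
      then obtain c where "e = c *s w" by (auto simp: in_span_single)
      then have "y = (\<beta> - \<mu>) *s x + c *s w" by (simp add: e_def algebra_simps)
      then have "y \<in> vec.span {x, w}" by (rule in_span_pairI)
      then show False using yxw' by simp
    qed
    show ?thesis using that[of "x + w"] 1 2 3 by (simp add: lin_indep_Cons MX)
  qed
qed

text \<open>
  Take \<open>t\<close> outside the span of \<open>x\<close> and its first two images. If \<open>t\<close> fails, then \<open>t + M x\<close> works: modulo the
  plane of \<open>x\<close> and \<open>M x\<close> it is still \<open>t\<close>, while its image changes by the image of \<open>M x\<close>, which is
  independent of \<open>t\<close> there.
\<close>

lemma two_independent_planes: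
  fixes M :: "'k::{field,finite} ^ 'n::finite ^ 'n"
  assumes n: "CARD('n) \<ge> 4" and ind: "lin_indep [M *v (M *v x), M *v x, x]"
  obtains t where "lin_indep [M *v t, t, M *v x, x]"
proof -
  define y z where "y = M *v x" and "z = M *v y"
  have zn: "z \<notin> vec.span {y, x}" and yx: "lin_indep [y, x]"
    using ind by (simp_all add: lin_indep_Cons y_def z_def)
  have "card {z, y, x} \<le> 3" by (simp add: card_insert_if)
  then obtain t where t: "t \<notin> vec.span {z, y, x}"
    using exists_outside_span[of "{z, y, x}"] n by auto
  have tyx: "t \<notin> vec.span {y, x}" using t vec.span_mono[of "{y, x}" "{z, y, x}"] by auto
  show ?thesis
  proof (cases "M *v t \<in> vec.span {t, y, x}")
    case False
    then show ?thesis using that[of t] tyx yx by (simp add: lin_indep_Cons y_def)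
  next
    case True
    have sp: "vec.span {t + y, y, x} = vec.span {t, y, x}"
    proof -
      have "t + y \<in> vec.span {t, y, x}" by (intro vec.span_add vec.span_base) auto
      moreover have "(t + y) - y \<in> vec.span {t + y, y, x}" by (intro vec.span_diff vec.span_base) auto
      ultimately show ?thesis unfolding vec.span_eq by (simp add: vec.span_base)
    qed
    have 1: "t + y \<notin> vec.span {y, x}"
    proof
      assume "t + y \<in> vec.span {y, x}"
      then have "(t + y) - y \<in> vec.span {y, x}" by (intro vec.span_diff) (auto intro: vec.span_base)
      then show False using tyx by simp
    qed
    have "M *v (t + y) \<notin> vec.span {t + y, y, x}"
    proof
      assume "M *v (t + y) \<in> vec.span {t + y, y, x}"
      then have "M *v t + z \<in> vec.span {t, y, x}" by (simp add: sp vec.add z_def)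
      then have "(M *v t + z) - M *v t \<in> vec.span {t, y, x}" using True by (intro vec.span_diff)
      then have "z \<in> vec.span (insert t {y, x})" by simp
      then have "t \<in> vec.span (insert z {y, x})" using vec.in_span_insert zn by blast
      then show False using t by simp
    qed
    then show ?thesis using that[of "t + y"] 1 yx by (simp add: lin_indep_Cons y_def)
  qed
qed

text \<open>
  If the first pattern never occurs, any \<open>x\<close> and its image span an invariant plane. For \<open>t\<close> off this
  plane, the plane of \<open>t\<close> is invariant too, and the two meet trivially, which is the second pattern:
  a common line, spanned by \<open>p\<close> in the proof, would consist of eigenvectors.
\<close>

lemma no_eigenvector_patterns:
  fixes M :: "'k::{field,finite} ^ 'n::finite ^ 'n"
  assumes n: "CARD('n) \<ge> 3" and no: "eigenvectors M = {}"
  shows "(\<exists>x. lin_indep [M *v (M *v x), M *v x, x]) \<or> (\<exists>x t. lin_indep [M *v t, t, M *v x, x])"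
proof (rule ccontr)
  assume neg: "\<not> ?thesis"
  have ne: "M *v x \<notin> vec.span {x}" if "x \<noteq> 0" for x using no that by (auto simp: eigenvectors_def)
  have inv: "M *v (M *v x) \<in> vec.span {M *v x, x}" if "x \<noteq> 0" for x
    using neg ne[OF that] that by (auto simp: lin_indep_Cons)
  define x :: "'k ^ 'n" where "x = axis undefined 1"
  have x: "x \<noteq> 0" by (simp add: x_def)
  define y where "y = M *v x"
  obtain \<beta> \<alpha> where My: "M *v y = \<beta> *s y + \<alpha> *s x" using inv[OF x] by (auto simp: in_span_pair y_def)
  have "card {y, x} \<le> 2" by (simp add: card_insert_if)
  then obtain t where t: "t \<notin> vec.span {y, x}"
    using exists_outside_span[of "{y, x}"] n by auto
  have tn: "t \<noteq> 0" using t vec.span_zero by auto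
  have "M *v t \<in> vec.span {t, y, x}"
    using neg t ne[OF x] x by (auto simp: lin_indep_Cons y_def)
  then obtain \<kappa> p1 p2 where Mt: "M *v t - \<kappa> *s t = p1 *s y + p2 *s x"
    by (auto simp: vec.span_insert[of t] in_span_pair)
  define p where "p = M *v t - \<kappa> *s t"
  have pP: "p = p1 *s y + p2 *s x" using Mt p_def by simp
  have Mt': "M *v t = \<kappa> *s t + p" by (simp add: p_def)
  obtain \<delta> \<epsilon> where MMt: "M *v (M *v t) = \<delta> *s (M *v t) + \<epsilon> *s t"
    using inv[OF tn] by (auto simp: in_span_pair)
  have Mp: "M *v p = M *v (M *v t) - \<kappa> *s (M *v t)" by (simp add: p_def vec.diff vec.scale)
  have Mp1: "M *v p = (p1 * \<beta> + p2) *s y + (p1 * \<alpha>) *s x"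
    by (simp add: pP vec.add vec.scale My y_def[symmetric] vec_eq_iff algebra_simps)
  have "M *v p = \<delta> *s (M *v t) + \<epsilon> *s t - \<kappa> *s (M *v t)" unfolding Mp MMt by (rule refl)
  then have eq: "((\<delta> - \<kappa>) * \<kappa> + \<epsilon>) *s t = M *v p - (\<delta> - \<kappa>) *s p"
    unfolding Mt' by (simp add: vec_eq_iff algebra_simps)
  have "M *v p - (\<delta> - \<kappa>) *s p = (p1 * \<beta> + p2 - (\<delta> - \<kappa>) * p1) *s y + (p1 * \<alpha> - (\<delta> - \<kappa>) * p2) *s x"
    unfolding Mp1 unfolding pP by (simp add: vec_eq_iff algebra_simps)
  then have "M *v p - (\<delta> - \<kappa>) *s p \<in> vec.span {y, x}" using comb_in_span_pair by metis
  then have "(\<delta> - \<kappa>) * \<kappa> + \<epsilon> = 0" using eq scale_in_span_imp_0[OF t] by metis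
  then have "M *v p = (\<delta> - \<kappa>) *s p" using eq by simp
  then have "M *v p \<in> vec.span {p}" by (rule in_span_singleI)
  then have "p = 0" using ne by blast
  then have "M *v t \<in> vec.span {t}" using Mt' by (auto simp: in_span_single)
  then show False using ne[OF tn] by simp
qed

section \<open>Dimension at least three\<close>

lemma eigenvectors_unique_line:
  fixes M :: "'k::{field,finite} ^ 'n::finite ^ 'n"
  assumes "card (eigenvectors M) = CARD('k) - 1"
  obtains v where "v \<in> eigenvectors M" "eigenvectors M \<subseteq> vec.span {v}"
proof -
  have "eigenvectors M \<noteq> {}" using assms CARD_gt_1[where 'k = 'k] by auto
  then obtain v where v: "v \<in> eigenvectors M" by blast
  then have vn: "v \<noteq> 0" by (simp add: eigenvectors_def)
  have "vec.span {v} - {0} \<subseteq> eigenvectors M"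
  proof
    fix x assume x: "x \<in> vec.span {v} - {0}"
    then have sp: "vec.span {x} = vec.span {v}" using span_singleton_sym[of x v] by simp
    have "M *v v \<in> vec.span {v}" using v by (simp add: eigenvectors_def)
    then show "x \<in> eigenvectors M" using matrix_maps_line_cong[OF sp[symmetric], of M v] x sp
      by (simp add: eigenvectors_def)
  qed
  moreover have "card (vec.span {v} - {0}) = card (eigenvectors M)"
    using card_span_singleton[OF vn] assms by (simp add: vec.span_zero)
  ultimately have "vec.span {v} - {0} = eigenvectors M" by (intro card_subset_eq) auto
  then show ?thesis using that[OF v] by blast
qed

lemma card_eigenvectors_two_lines:
  fixes M :: "'k::{field,finite} ^ 'n::finite ^ 'n"
  assumes "x \<in> eigenvectors M" "y \<in> eigenvectors M" "x \<notin> vec.span {y}"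
  shows "card (eigenvectors M) \<noteq> CARD('k) - 1"
proof
  assume "card (eigenvectors M) = CARD('k) - 1"
  then obtain v where v: "v \<in> eigenvectors M" "eigenvectors M \<subseteq> vec.span {v}"
    by (rule eigenvectors_unique_line)
  have "y \<noteq> 0" using assms(2) by (simp add: eigenvectors_def)
  then have "vec.span {y} = vec.span {v}" using v(2) assms(2) span_singleton_sym[of y v] by blast
  then show False using assms v(2) by blast
qed

text \<open>
  The product fixes the line of \<open>x\<close> as soon as the conjugate of \<open>b\<close> maps it to the same line as the
  inverse of \<open>a\<close> does.
\<close>

lemma conj_by_fixes_line:
  fixes a b g :: "'k::{field,finite} ^ 'n::finite ^ 'n"
  assumes a: "det a = 1" and g: "det g = 1" and un: "u \<noteq> 0" and xn: "x \<noteq> 0"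
    and gu: "g *v u \<in> vec.span {x}" and gbu: "g *v (b *v u) \<in> vec.span {matrix_inv a *v x}"
  shows "x \<in> eigenvectors (a ** conj_by g b)"
proof -
  have "g *v u \<noteq> 0" using det_1_inj[OF g, of u 0] un by simp
  then have sp: "vec.span {g *v u} = vec.span {x}" using gu span_singleton_sym by blast
  have "conj_by g b *v x \<in> vec.span {matrix_inv a *v x}"
    by (rule matrix_maps_line_cong[OF sp]) (simp add: conj_by_apply[OF g] gbu)
  then have "a *v (conj_by g b *v x) \<in> vec.span ((*v) a ` {matrix_inv a *v x})"
    by (rule matrix_vector_span)
  moreover have "a *v (matrix_inv a *v x) = x"
    using matrix_inv_mult(2)[OF a] by (simp add: matrix_vector_mul_assoc)
  ultimately show ?thesis using xn by (simp add: eigenvectors_def matrix_vector_mul_assoc)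
qed

text \<open>
  One of three patterns occurs for \<open>b\<close>: an eigenvector \<open>w\<close> together with an independent pair
  \<open>u, b u\<close>; or \<open>u, b u, b (b u)\<close> independent; or \<open>u, b u, s, b s\<close> independent. The inverse of \<open>a\<close>, having
  exactly one eigenline, shows the first two, and in dimension at least \<open>4\<close> the third. Carrying the
  pattern of \<open>b\<close> to the same pattern of the inverse of \<open>a\<close> makes both agree on two lines.
\<close>

lemma two_fixed_lines:
  fixes a b :: "'k::{field,finite} ^ 'n::finite ^ 'n"
  assumes n: "CARD('n) \<ge> 3" and a: "det a = 1" and an: "a \<notin> range mat" and bn: "b \<notin> range mat"
    and one: "card (eigenvectors a) = CARD('k) - 1"
  shows "\<exists>g. det g = 1 \<and> card (eigenvectors (a ** conj_by g b)) \<noteq> CARD('k) - 1"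
proof -
  let ?a = "matrix_inv a"
  have ev: "eigenvectors ?a = eigenvectors a" by (rule eigenvectors_matrix_inv[OF a])
  have an': "?a \<notin> range mat"
  proof
    assume "?a \<in> range mat"
    then obtain c where c: "?a = mat c" by blast
    have "mat 1 = a ** mat c" using matrix_inv_mult(2)[OF a] c by simp
    then have 1: "(if i = j then 1 else 0) = c * a $ i $ j" for i j
      unfolding mat_mult_right by (simp add: mat_def vec_eq_iff)
    then have cn: "c \<noteq> 0" by (metis mult_zero_left zero_neq_one)
    have "a $ i $ j = mat (inverse c) $ i $ j" for i j
      using 1[of i j] cn by (auto simp: mat_def field_simps split: if_splits)
    then have "a = mat (inverse c)" unfolding vec_eq_iff by blast
    then show False using an by blast
  qed
  obtain v where v: "v \<in> eigenvectors ?a" "eigenvectors ?a \<subseteq> vec.span {v}"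
    using eigenvectors_unique_line[OF one] ev by metis
  obtain x where x: "lin_indep [?a *v (?a *v x), ?a *v x, x]"
    using cyclic_vector_of_degree_3[OF n an' v] .
  have result: ?thesis if "det g = 1" "x1 \<in> eigenvectors (a ** conj_by g b)"
    "x2 \<in> eigenvectors (a ** conj_by g b)" "x2 \<notin> vec.span {x1}" for g x1 x2
    using card_eigenvectors_two_lines[OF that(3,2,4)] that(1) by blast
  show ?thesis
  proof (cases "eigenvectors b = {}")
    case False
    then obtain w0 where "w0 \<in> eigenvectors b" by blast
    then obtain w u where w: "w \<in> eigenvectors b" and wu: "lin_indep [b *v u, u, w]"
      using eigenvector_and_nonscalar_quotient[OF n bn] by blast
    obtain w' y where w': "w' \<in> eigenvectors ?a" and wy: "lin_indep [?a *v y, y, w']"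
      using eigenvector_and_nonscalar_quotient[OF n an' v(1)] .
    obtain g :: "'k ^ 'n ^ 'n" where g: "det g = 1" "\<And>i. i < length [b *v u, u, w] \<Longrightarrow>
        g *v ([b *v u, u, w] ! i) \<in> vec.span {[?a *v y, y, w'] ! i}"
      by (rule SL_transitive_on_frames[OF wu wy]) auto
    have g0: "g *v (b *v u) \<in> vec.span {?a *v y}" and g1: "g *v u \<in> vec.span {y}"
      and g2: "g *v w \<in> vec.span {w'}" using g(2)[of 0] g(2)[of 1] g(2)[of 2] by simp_all
    have yw: "y \<notin> vec.span {w'}" and uw: "u \<notin> vec.span {w}" using wy wu by (simp_all add: lin_indep_Cons)
    have nz: "y \<noteq> 0" "u \<noteq> 0" using yw uw vec.span_zero by auto
    have wz: "w \<noteq> 0" "w' \<noteq> 0" "b *v w \<in> vec.span {w}" "?a *v w' \<in> vec.span {w'}"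
      using w w' by (simp_all add: eigenvectors_def)
    have "g *v (b *v w) \<in> vec.span ((*v) g ` {w})" by (rule matrix_vector_span[OF wz(3)])
    moreover have "vec.span {g *v w} = vec.span {w'}"
      using span_singleton_sym[OF g2] det_1_inj[OF g(1), of w 0] wz by simp
    moreover have "vec.span {?a *v w'} = vec.span {w'}"
      using span_singleton_sym[OF wz(4)] det_1_inj[OF matrix_inv_mult(3)[OF a], of w' 0] wz by simp
    ultimately have "g *v (b *v w) \<in> vec.span {?a *v w'}" by simp
    then have "w' \<in> eigenvectors (a ** conj_by g b)"
      by (rule conj_by_fixes_line[OF a g(1) wz(1,2) g2])
    moreover have "y \<in> eigenvectors (a ** conj_by g b)"
      by (rule conj_by_fixes_line[OF a g(1) nz(2,1) g1 g0])
    ultimately show ?thesis using result[OF g(1)] yw by blast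
  next
    case True
    from no_eigenvector_patterns[OF n True] show ?thesis
    proof
      assume "\<exists>u. lin_indep [b *v (b *v u), b *v u, u]"
      then obtain u where u: "lin_indep [b *v (b *v u), b *v u, u]" by blast
      obtain g :: "'k ^ 'n ^ 'n" where g: "det g = 1" "\<And>i. i < length [b *v (b *v u), b *v u, u] \<Longrightarrow>
          g *v ([b *v (b *v u), b *v u, u] ! i) \<in> vec.span {[?a *v (?a *v x), ?a *v x, x] ! i}"
        by (rule SL_transitive_on_frames[OF u x]) auto
      have g0: "g *v (b *v (b *v u)) \<in> vec.span {?a *v (?a *v x)}" and g1: "g *v (b *v u) \<in> vec.span {?a *v x}"
        and g2: "g *v u \<in> vec.span {x}" using g(2)[of 0] g(2)[of 1] g(2)[of 2] by simp_all
      have ind: "?a *v x \<notin> vec.span {x}" "x \<noteq> 0" "b *v u \<notin> vec.span {u}" "u \<noteq> 0"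
        using x u by (simp_all add: lin_indep_Cons)
      have nz: "?a *v x \<noteq> 0" "b *v u \<noteq> 0"
        using ind(1,3) vec.span_zero[of "{x}"] vec.span_zero[of "{u}"] by auto
      have "x \<in> eigenvectors (a ** conj_by g b)"
        by (rule conj_by_fixes_line[OF a g(1) ind(4,2) g2 g1])
      moreover have "?a *v x \<in> eigenvectors (a ** conj_by g b)"
        by (rule conj_by_fixes_line[OF a g(1) nz(2,1) g1 g0])
      ultimately show ?thesis using result[OF g(1)] ind by blast
    next
      assume "\<exists>u s. lin_indep [b *v s, s, b *v u, u]"
      then obtain u s where us: "lin_indep [b *v s, s, b *v u, u]" by blast
      \<comment> \<open>The pattern of \<open>b\<close> itself provides the four dimensions that \<open>a\<close> needs to show it.\<close>
      have "CARD('n) \<ge> 4" using lin_indep_length[OF us] by simp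
      then obtain t where t: "lin_indep [?a *v t, t, ?a *v x, x]"
        using two_independent_planes[OF _ x] by blast
      obtain g :: "'k ^ 'n ^ 'n" where g: "det g = 1" "\<And>i. i < length [b *v s, s, b *v u, u] \<Longrightarrow>
          g *v ([b *v s, s, b *v u, u] ! i) \<in> vec.span {[?a *v t, t, ?a *v x, x] ! i}"
        by (rule SL_transitive_on_frames[OF us t]) auto
      have g0: "g *v (b *v s) \<in> vec.span {?a *v t}" and g1: "g *v s \<in> vec.span {t}"
        and g2: "g *v (b *v u) \<in> vec.span {?a *v x}" and g3: "g *v u \<in> vec.span {x}"
        using g(2)[of 0] g(2)[of 1] g(2)[of 2] g(2)[of 3] by (simp_all add: numeral_3_eq_3)
      have ind: "t \<notin> vec.span {?a *v x, x}" "x \<noteq> 0" "s \<notin> vec.span {b *v u, u}" "u \<noteq> 0"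
        using t us by (simp_all add: lin_indep_Cons)
      have nz: "t \<noteq> 0" "s \<noteq> 0" using ind vec.span_zero by auto
      have "t \<notin> vec.span {x}" using ind(1) vec.span_mono[of "{x}" "{?a *v x, x}"] by auto
      moreover have "x \<in> eigenvectors (a ** conj_by g b)"
        by (rule conj_by_fixes_line[OF a g(1) ind(4,2) g3 g2])
      moreover have "t \<in> eigenvectors (a ** conj_by g b)"
        by (rule conj_by_fixes_line[OF a g(1) nz(2,1) g1 g0])
      ultimately show ?thesis using result[OF g(1)] by blast
    qed
  qed
qed

section \<open>Dimension two\<close>

lemma eigenvalue_iff_det:
  fixes M :: "'k::{field,finite} ^ 'n::finite ^ 'n"
  shows "(\<exists>x. x \<noteq> 0 \<and> M *v x = c *s x) \<longleftrightarrow> det (M - mat c) = 0"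
proof -
  have "det (M - mat c) \<noteq> 0 \<longleftrightarrow> (\<exists>B. B ** (M - mat c) = mat 1)"
    by (simp add: invertible_det_nz[symmetric] invertible_left_inverse)
  also have "\<dots> \<longleftrightarrow> (\<forall>x. M *v x - c *s x = 0 \<longrightarrow> x = 0)"
    by (simp add: matrix_left_invertible_ker matrix_vector_mult_diff_rdistrib mat_mult_vector)
  finally show ?thesis by auto
qed

lemma det_two:
  fixes M :: "'k::{field,finite} ^ 'n::finite ^ 'n" and i j :: 'n
  assumes ij: "i \<noteq> j" "UNIV = {i, j}"
  shows "det M = M $ i $ i * M $ j $ j - M $ i $ j * M $ j $ i"
proof -
  have f: "finite {j}" "i \<notin> {j}" using ij by auto
  show ?thesis
    unfolding det_def ij(2)
    unfolding sum_over_permutations_insert[OF f] permutes_sing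
    using ij(1) by (simp add: sign_swap_id sign_id swap_id_eq)
qed

lemma sum_two:
  fixes i j :: "'n::finite" and f :: "'n \<Rightarrow> 'a::comm_monoid_add"
  assumes "i \<noteq> j" "UNIV = {i, j}"
  shows "sum f UNIV = f i + f j"
  unfolding assms(2) using assms(1) by simp

lemma matrix_mult_two:
  fixes A B :: "'k::{field,finite} ^ 'n::finite ^ 'n" and i j :: 'n
  assumes "i \<noteq> j" "UNIV = {i, j}"
  shows "(A ** B) $ r $ c = A $ r $ i * B $ i $ c + A $ r $ j * B $ j $ c"
  by (simp add: matrix_matrix_mult_def sum_two[OF assms])

lemma trace_two:
  fixes A :: "'k::{field,finite} ^ 'n::finite ^ 'n" and i j :: 'n
  assumes "i \<noteq> j" "UNIV = {i, j}" shows "trace A = A $ i $ i + A $ j $ j"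
  by (simp add: trace_def sum_two[OF assms])

lemma scalar_two:
  fixes A :: "'k::{field,finite} ^ 'n::finite ^ 'n" and i j :: 'n
  assumes ij: "i \<noteq> j" "UNIV = {i, j}"
  shows "A \<in> range mat \<longleftrightarrow> A $ i $ j = 0 \<and> A $ j $ i = 0 \<and> A $ i $ i = A $ j $ j"
proof
  assume s: "A $ i $ j = 0 \<and> A $ j $ i = 0 \<and> A $ i $ i = A $ j $ j"
  have "A $ r $ c = mat (A $ i $ i) $ r $ c" for r c
  proof -
    have "r = i \<or> r = j" "c = i \<or> c = j" using ij(2) by blast+
    then show ?thesis using s ij(1) by (auto simp: mat_def)
  qed
  then have "A = mat (A $ i $ i)" unfolding vec_eq_iff by blast
  then show "A \<in> range mat" by blast
qed (use ij(1) in \<open>auto simp: mat_def\<close>)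

text \<open>
  With an eigenvalue \<open>c\<close>, its inverse is the other root of the characteristic polynomial. As there is
  only one eigenline, the two coincide, so \<open>c\<close> is \<open>1\<close> or \<open>-1\<close> and the trace is \<open>2 c\<close>. The squared form
  of the conclusion also covers characteristic \<open>2\<close>.
\<close>

lemma one_line_trace:
  fixes M :: "'k::{field,finite} ^ 'n::finite ^ 'n" and i j :: 'n
  assumes ij: "i \<noteq> j" "UNIV = {i, j}" and M: "det M = 1" and one: "card (eigenvectors M) = CARD('k) - 1"
  shows "(trace M)\<^sup>2 = 4"
proof -
  obtain v where v: "v \<in> eigenvectors M" "eigenvectors M \<subseteq> vec.span {v}"
    using eigenvectors_unique_line[OF one] .
  then obtain c where c: "v \<noteq> 0" "M *v v = c *s v" by (auto simp: eigenvectors_def in_span_single)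
  have cn: "c \<noteq> 0" using c det_1_inj[OF M, of v 0] by auto
  have char: "det (M - mat d) = d\<^sup>2 - trace M * d + 1" for d
    using M unfolding det_two[OF ij]
    using ij(1) by (simp add: trace_def sum_two[OF ij] mat_def power2_eq_square algebra_simps)
  have e: "c\<^sup>2 - trace M * c + 1 = 0" using eigenvalue_iff_det[of M c] char c by auto
  have "(inverse c)\<^sup>2 - trace M * inverse c + 1 = (c\<^sup>2 - trace M * c + 1) * (inverse c)\<^sup>2"
    using cn by (simp add: field_simps power2_eq_square)
  then have "det (M - mat (inverse c)) = 0" using char e by simp
  then obtain w where w: "w \<noteq> 0" "M *v w = inverse c *s w" using eigenvalue_iff_det by blast
  then have "w \<in> vec.span {v}" using v(2) by (auto simp: eigenvectors_def in_span_single)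
  then obtain r where r: "w = r *s v" by (auto simp: in_span_single)
  have "M *v w = c *s w" by (simp add: r vec.scale c vec.scale_left_commute)
  then have "inverse c = c" using w by simp
  then have c2: "c * c = 1" using cn by (metis left_inverse)
  have "trace M * c = 2" using e c2 by (simp add: power2_eq_square algebra_simps)
  then have "trace M = 2 * c" using c2 by (metis mult.assoc mult.right_neutral)
  then have "(trace M)\<^sup>2 = 4 * (c * c)" by (simp add: power2_eq_square)
  then show ?thesis using c2 by simp
qed

text \<open>
  The hypothesis puts \<open>\<mu> t (t - \<tau>)\<close> into \<open>{0, - 2 w}\<close> for every \<open>t\<close>. Each of the two values is taken at
  most at two points, which the reflection \<open>t \<mapsto> \<tau> - t\<close> exchanges. That leaves at most four field
  elements. In characteristic \<open>2\<close> the two values coincide and at most two elements remain;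
  otherwise the reflection has the fixed point \<open>\<tau> / 2\<close>, so two of the four candidates coincide.
\<close>

lemma card_le_3_of_two_quadratic_values:
  fixes \<tau> \<mu> w :: "'k::{field,finite}"
  assumes \<mu>: "\<mu> \<noteq> 0" and all: "\<And>t. (w + \<mu> * (t\<^sup>2 - \<tau> * t))\<^sup>2 = w\<^sup>2"
  shows "CARD('k) \<le> 3"
proof -
  have small: "CARD('k) \<le> 3" if "\<And>t. t \<in> {x, y, z}" for x y z :: 'k
  proof -
    have "UNIV = {x, y, z}" using that by blast
    moreover have "card {x, y, z} \<le> 3" by (simp add: card_insert_if)
    ultimately show ?thesis by simp
  qed
  have split: "t * (t - \<tau>) = 0 \<or> \<mu> * (t * (t - \<tau>)) = - (2 * w)" for t
  proof -
    have "\<mu> * (t * (t - \<tau>)) * (\<mu> * (t * (t - \<tau>)) + 2 * w) = (w + \<mu> * (t\<^sup>2 - \<tau> * t))\<^sup>2 - w\<^sup>2"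
      by (simp add: power2_eq_square algebra_simps)
    also have "\<dots> = 0" using all by simp
    finally show ?thesis using \<mu> by (auto simp: eq_neg_iff_add_eq_0)
  qed
  show ?thesis
  proof (cases "\<forall>t. t * (t - \<tau>) = 0")
    case True
    then have "t \<in> {0, \<tau>, \<tau>}" for t using mult_eq_0_iff[of t "t - \<tau>"] by auto
    then show ?thesis by (rule small)
  next
    case False
    then obtain s where s: "s * (s - \<tau>) \<noteq> 0" by blast
    then have s': "\<mu> * (s * (s - \<tau>)) = - (2 * w)" using split by blast
    have two: "(2 :: 'k) \<noteq> 0"
    proof
      assume "(2 :: 'k) = 0"
      then have "\<mu> * (s * (s - \<tau>)) = 0" using s' by simp
      then show False using s \<mu> by simp
    qed
    have cover: "t \<in> {0, \<tau>, s, \<tau> - s}" for t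
    proof (cases "t * (t - \<tau>) = 0")
      case True
      then show ?thesis by auto
    next
      case False
      then have "\<mu> * (t * (t - \<tau>)) = \<mu> * (s * (s - \<tau>))" using split[of t] s' by simp
      then have "t * (t - \<tau>) = s * (s - \<tau>)" using \<mu> by simp
      then have "(t - s) * (t - (\<tau> - s)) = 0" by (simp add: algebra_simps)
      then show ?thesis by auto
    qed
    define h where "h = \<tau> / 2"
    have h: "h + h = \<tau>" using two by (simp add: h_def field_simps)
    have "\<tau> = 0 \<or> s = \<tau> - s"
    proof -
      have "h = 0 \<or> h = \<tau> \<or> h = s \<or> h = \<tau> - s" using cover[of h] by simp
      moreover have "\<tau> = 0" if "h = 0" using h that by simp
      moreover have "\<tau> = 0" if e: "h = \<tau>"
      proof -
        have "h + h = h + 0" using h e by simp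
        then have "h = 0" by (simp only: add_left_cancel)
        then show ?thesis using e by simp
      qed
      moreover have "s = \<tau> - s" if "h = s" using h that by (simp add: eq_diff_eq)
      moreover have "s = \<tau> - s" if e: "h = \<tau> - s"
      proof -
        have "s = \<tau> - h" using e by simp
        also have "\<dots> = h" using h by (simp add: diff_eq_eq)
        finally show ?thesis using e by simp
      qed
      ultimately show ?thesis by blast
    qed
    then consider "\<tau> = 0" | "s = \<tau> - s" by blast
    then show ?thesis
    proof cases
      case 1
      then have "t \<in> {0, s, \<tau> - s}" for t using cover[of t] by auto
      then show ?thesis by (rule small)
    next
      case 2
      then have "t \<in> {0, \<tau>, s}" for t using cover[of t] by auto
      then show ?thesis by (rule small)
    qed
  qed
qed

text \<open>
  In suitable coordinates \<open>a\<close> is upper triangular with equal diagonal entries \<open>d\<close> and upper right entry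
  \<open>\<mu> \<noteq> 0\<close>. So the trace of \<open>a b\<^sup>g\<close> is \<open>d tr(b)\<close> plus \<open>\<mu>\<close> times the lower left entry of \<open>b\<^sup>g\<close>. Over the
  conjugates of \<open>b\<close> this entry takes, for some \<open>k0 \<noteq> 0\<close>, all values \<open>k0 (1 - \<tau> t + t\<^sup>2)\<close>, where \<open>\<tau>\<close> is the
  trace of \<open>b\<close>. If all products have one fixed line, the square of each such trace is \<open>4\<close>.
\<close>

lemma field_size_of_constant_one_line:
  fixes a b :: "'k::{field,finite} ^ 'n::finite ^ 'n"
  assumes n: "CARD('n) = 2" and a: "det a = 1" "a \<notin> range mat" and b: "det b = 1" "b \<notin> range mat"
    and one: "card (eigenvectors a) = CARD('k) - 1"
    and m: "\<And>g. det g = 1 \<Longrightarrow> card (eigenvectors (a ** conj_by g b)) = CARD('k) - 1"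
  shows "CARD('k) \<le> 3"
proof -
  obtain i j :: 'n where ij: "i \<noteq> j" "UNIV = {i, j}"
    using n by (auto simp: card_2_iff)
  note d2 = det_two[OF ij]
  note mul = matrix_mult_two[OF ij] and tr = trace_two[OF ij] and scalar = scalar_two[OF ij]
  define e where "e = (\<lambda>l. axis l 1 :: 'k ^ 'n)"
  have en: "e l \<noteq> 0" for l by (simp add: e_def)
  have eij: "e j \<notin> vec.span {e i}"
  proof
    assume "e j \<in> vec.span {e i}"
    then obtain r where "e j = r *s e i" by (auto simp: in_span_single)
    then have "e j $ j = r * e i $ j" by simp
    then show False using ij(1) by (simp add: e_def axis_def)
  qed
  \<comment> \<open>Conjugate \<open>a\<close> so that its eigenline becomes the first coordinate axis.\<close>
  obtain v where v: "v \<in> eigenvectors a" using eigenvectors_unique_line[OF one] by blast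
  then have vn: "v \<noteq> 0" by (simp add: eigenvectors_def)
  have "lin_indep [v]" "lin_indep [e i]" using vn en by (simp_all add: lin_indep_Cons)
  then obtain h :: "'k ^ 'n ^ 'n" where h: "det h = 1" "\<And>l. l < length [v] \<Longrightarrow> h *v ([v] ! l) \<in> vec.span {[e i] ! l}"
    by (rule SL_transitive_on_frames) auto
  define a1 where "a1 = conj_by h a"
  have det1: "det a1 = 1" by (simp add: a1_def det_conj_by h a)
  have one1: "card (eigenvectors a1) = CARD('k) - 1"
    by (simp add: a1_def card_eigenvectors_conj_by h one)
  have a1n: "a1 \<notin> range mat"
  proof
    assume "a1 \<in> range mat"
    then obtain c where "a1 = mat c" by blast
    then have "a1 *v x \<in> vec.span {x}" for x by (simp add: mat_mult_vector vec.span_scale vec.span_base)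
    then have "e i \<in> eigenvectors a1" "e j \<in> eigenvectors a1" using en by (simp_all add: eigenvectors_def)
    then show False using card_eigenvectors_two_lines eij one1 by blast
  qed
  have hv: "h *v v \<in> eigenvectors a1" using v by (simp add: a1_def eigenvectors_conj_by h)
  have "vec.span {h *v v} = vec.span {e i}"
    using span_singleton_sym[of "h *v v" "e i"] h(2)[of 0] det_1_inj[OF h(1), of v 0] vn by simp
  then have "a1 *v e i \<in> vec.span {e i}"
    using hv matrix_maps_line_cong[of "h *v v" "e i" a1 "e i"] by (simp add: eigenvectors_def)
  then obtain c where c: "a1 *v e i = c *s e i" by (auto simp: in_span_single)
  have col: "(A *v e l) $ r = A $ r $ l" for A :: "'k ^ 'n ^ 'n" and r l
    by (simp add: e_def matrix_vector_axis)
  have aji: "a1 $ j $ i = 0" using col[of a1 i j] c ij(1) by (simp add: e_def axis_def)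
  have m1: "(trace (a1 ** conj_by g b))\<^sup>2 = 4" if g: "det g = 1" for g
  proof -
    have d: "det (matrix_inv h ** g) = 1" using g matrix_inv_mult(3)[OF h(1)] by (simp add: det_mul)
    have "conj_by h (a ** conj_by (matrix_inv h ** g) b) = a1 ** conj_by (h ** (matrix_inv h ** g)) b"
      by (simp add: conj_by_matrix_mult[OF h(1)] conj_by_mult[OF h(1) d] a1_def)
    also have "h ** (matrix_inv h ** g) = g"
      using matrix_inv_mult(2)[OF h(1)] by (simp add: matrix_mul_assoc)
    finally have "trace (a1 ** conj_by g b) = trace (a ** conj_by (matrix_inv h ** g) b)"
      using trace_conj_by[OF h(1), of "a ** conj_by (matrix_inv h ** g) b"] by simp
    moreover have "(trace (a ** conj_by (matrix_inv h ** g) b))\<^sup>2 = 4"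
      using m[OF d] by (intro one_line_trace[OF ij]) (simp_all add: det_mul a b det_conj_by[OF d])
    ultimately show ?thesis by simp
  qed
  have aii: "a1 $ i $ i * a1 $ j $ j = 1" using det1 aji by (simp add: d2)
  have diag: "a1 $ j $ j = a1 $ i $ i"
  proof -
    have "(trace a1)\<^sup>2 = 4" by (rule one_line_trace[OF ij det1 one1])
    then have "(a1 $ i $ i - a1 $ j $ j)\<^sup>2 = 4 - 4 * (a1 $ i $ i * a1 $ j $ j)"
      unfolding tr by (simp add: power2_eq_square algebra_simps)
    then show ?thesis using aii by simp
  qed
  define \<mu> where "\<mu> = a1 $ i $ j"
  have \<mu>: "\<mu> \<noteq> 0" using scalar[of a1] a1n aji diag by (auto simp: \<mu>_def)
  define d where "d = a1 $ i $ i"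
  have tr1: "trace (a1 ** B) = d * trace B + \<mu> * B $ j $ i" for B
    by (simp add: tr mul aji diag d_def \<mu>_def algebra_simps)
  \<comment> \<open>Conjugate \<open>b\<close> so that it maps the first coordinate axis to the second.\<close>
  obtain u where u: "b *v u \<notin> vec.span {u}" using nonscalar_noneigenvector[OF b(2)] .
  then have un: "u \<noteq> 0" using vec.span_zero by auto
  have "lin_indep [b *v u, u]" "lin_indep [e j, e i]" using u un eij en by (simp_all add: lin_indep_Cons)
  then obtain g0 :: "'k ^ 'n ^ 'n" where g0: "det g0 = 1"
    "\<And>l. l < length [b *v u, u] \<Longrightarrow> g0 *v ([b *v u, u] ! l) \<in> vec.span {[e j, e i] ! l}"
    by (rule SL_transitive_on_frames) auto
  define B where "B = conj_by g0 b"
  have detB: "det B = 1" by (simp add: B_def det_conj_by g0 b)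
  have "vec.span {g0 *v u} = vec.span {e i}"
    using span_singleton_sym[of "g0 *v u" "e i"] g0(2)[of 1] det_1_inj[OF g0(1), of u 0] un by simp
  moreover have "B *v (g0 *v u) \<in> vec.span {e j}"
    using g0(2)[of 0] by (simp add: B_def conj_by_apply[OF g0(1)])
  ultimately have "B *v e i \<in> vec.span {e j}" by (rule matrix_maps_line_cong)
  then obtain k where k: "B *v e i = k *s e j" by (auto simp: in_span_single)
  have Bii: "B $ i $ i = 0" using col[of B i i] k ij(1) by (simp add: e_def axis_def)
  have Bdet: "- (B $ i $ j * B $ j $ i) = 1" using detB Bii by (simp add: d2)
  define k0 where "k0 = B $ j $ i"
  have k0: "k0 \<noteq> 0" using Bdet by (auto simp: k0_def)
  have Bij: "B $ i $ j = - inverse k0" using Bdet k0 by (simp add: k0_def field_simps) (metis minus_equation_iff)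
  define \<tau> where "\<tau> = B $ j $ j"
  have trb: "trace B = \<tau>" by (simp add: tr Bii \<tau>_def)
  have key: "(d * \<tau> + \<mu> * (k0 * (1 - \<tau> * t + t\<^sup>2)))\<^sup>2 = 4" for t
  proof -
    \<comment> \<open>The lower left entry of the conjugate by \<open>g\<close> only depends on the second row of \<open>g\<close>; the row
      \<open>(k0, t)\<close> makes it a multiple of a monic polynomial in \<open>t\<close>. The matrix \<open>g'\<close> is the inverse of \<open>g\<close>.\<close>
    define g :: "'k ^ 'n ^ 'n" where "g = (\<chi> r c. if r = i then (if c = i then 0 else - inverse k0) else (if c = i then k0 else t))"
    define g' :: "'k ^ 'n ^ 'n" where "g' = (\<chi> r c. if r = i then (if c = i then t else inverse k0) else (if c = i then - k0 else 0))"
    have ge: "g $ i $ i = 0" "g $ i $ j = - inverse k0" "g $ j $ i = k0" "g $ j $ j = t"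
      "g' $ i $ i = t" "g' $ i $ j = inverse k0" "g' $ j $ i = - k0" "g' $ j $ j = 0"
      using ij(1) by (auto simp: g_def g'_def)
    have detg: "det g = 1" using k0 by (simp add: d2 ge)
    have "g ** g' = mat 1"
    proof -
      have "(g ** g') $ r $ c = mat 1 $ r $ c" for r c
      proof -
        have "r = i \<or> r = j" "c = i \<or> c = j" using ij(2) by blast+
        then show ?thesis using ij(1) k0 by (auto simp: mul ge mat_def)
      qed
      then show ?thesis unfolding vec_eq_iff by blast
    qed
    then have "matrix_inv g = g'"
      using matrix_inv_mult(1)[OF detg] by (metis matrix_mul_assoc matrix_mul_lid matrix_mul_rid)
    then have "conj_by g B $ j $ i = (g ** B ** g') $ j $ i" by (simp add: conj_by_def)
    also have "\<dots> = k0 * (1 - \<tau> * t + t\<^sup>2)"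
      using k0 by (simp add: mul ge Bii Bij k0_def[symmetric] \<tau>_def[symmetric] power2_eq_square algebra_simps)
    finally have ji: "conj_by g B $ j $ i = k0 * (1 - \<tau> * t + t\<^sup>2)" .
    have "conj_by (g ** g0) b = conj_by g B" by (simp add: B_def conj_by_mult[OF detg g0(1)])
    moreover have "det (g ** g0) = 1" by (simp add: det_mul detg g0)
    ultimately have "(trace (a1 ** conj_by g B))\<^sup>2 = 4" using m1[of "g ** g0"] by simp
    then show ?thesis unfolding tr1 ji trace_conj_by[OF detg] trb .
  qed
  have "(d * \<tau> + \<mu> * k0 + \<mu> * k0 * (t\<^sup>2 - \<tau> * t))\<^sup>2 = (d * \<tau> + \<mu> * k0)\<^sup>2" for t
  proof -
    have e: "d * \<tau> + \<mu> * k0 + \<mu> * k0 * (t\<^sup>2 - \<tau> * t) = d * \<tau> + \<mu> * (k0 * (1 - \<tau> * t + t\<^sup>2))"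
      by (simp add: algebra_simps)
    have "(d * \<tau> + \<mu> * k0)\<^sup>2 = 4" using key[of 0] by simp
    then show ?thesis unfolding e key by (rule sym)
  qed
  then show ?thesis using \<mu> k0 by (intro card_le_3_of_two_quadratic_values[of "\<mu> * k0"]) auto
qed

section \<open>The projective group\<close>

text \<open>
  The elements \<open>h\<close> with \<open>U h \<subseteq> U\<close> form a subgroup, because \<open>U\<close> is finite, and a normal one, because \<open>U\<close> is
  closed under conjugation. It contains \<open>b\<close>, so it is the whole group, and then \<open>U\<close> contains \<open>u u\<^sup>-\<^sup>1\<close>.
\<close>

lemma simple_group_absorbing_set:
  fixes G (structure)
  assumes "simple_group G" and fin: "finite (carrier G)"
    and U: "U \<subseteq> carrier G" "U \<noteq> {}"
    and conj: "\<And>g u. g \<in> carrier G \<Longrightarrow> u \<in> U \<Longrightarrow> g \<otimes> u \<otimes> inv g \<in> U"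
    and b: "b \<in> carrier G" "b \<noteq> \<one>" "\<And>u. u \<in> U \<Longrightarrow> u \<otimes> b \<in> U"
  shows "\<one> \<in> U"
proof -
  interpret simple_group G by fact
  define H where "H = {h \<in> carrier G. \<forall>u\<in>U. u \<otimes> h \<in> U}"
  have finU: "finite U" using U(1) fin finite_subset by blast
  have Uc: "u \<in> carrier G" if "u \<in> U" for u using U(1) that by blast
  have sub: "subgroup H G"
  proof (rule subgroupI)
    show "H \<subseteq> carrier G" by (auto simp: H_def)
    have "\<one> \<in> H" using Uc by (simp add: H_def)
    then show "H \<noteq> {}" by blast
  next
    fix h assume h: "h \<in> H"
    then have hc: "h \<in> carrier G" by (simp add: H_def)
    have "inj_on (\<lambda>u. u \<otimes> h) U" using Uc hc by (auto intro!: inj_onI)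
    moreover have "(\<lambda>u. u \<otimes> h) ` U \<subseteq> U" using h by (auto simp: H_def)
    ultimately have surj: "(\<lambda>u. u \<otimes> h) ` U = U" by (intro endo_inj_surj[OF finU])
    have "u \<otimes> inv h \<in> U" if u: "u \<in> U" for u
    proof -
      obtain u' where u': "u' \<in> U" "u = u' \<otimes> h" using surj u by blast
      have "u \<otimes> inv h = u'" using u' Uc hc by (simp add: m_assoc)
      then show ?thesis using u' by simp
    qed
    then show "inv h \<in> H" using hc by (simp add: H_def)
  next
    fix g h assume "g \<in> H" "h \<in> H"
    then show "g \<otimes> h \<in> H" using Uc by (simp add: H_def flip: m_assoc)
  qed
  have "x \<otimes> h \<otimes> inv x \<in> H" if x: "x \<in> carrier G" and h: "h \<in> H" for x h
  proof -
    have hc: "h \<in> carrier G" using h by (simp add: H_def)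
    have "u \<otimes> (x \<otimes> h \<otimes> inv x) \<in> U" if u: "u \<in> U" for u
    proof -
      have "inv x \<otimes> u \<otimes> inv (inv x) \<in> U" using conj u x by blast
      then have "inv x \<otimes> u \<otimes> x \<otimes> h \<in> U" using h x by (simp add: H_def)
      then have "x \<otimes> (inv x \<otimes> u \<otimes> x \<otimes> h) \<otimes> inv x \<in> U" using conj x by blast
      moreover have "x \<otimes> (inv x \<otimes> u \<otimes> x \<otimes> h) = u \<otimes> x \<otimes> h"
        using x hc Uc[OF u] inv_closed[OF x] by (simp add: r_inv flip: m_assoc)
      ultimately have "u \<otimes> x \<otimes> h \<otimes> inv x \<in> U" by (simp only:)
      then show ?thesis using x hc Uc[OF u] by (simp add: m_assoc)
    qed
    then show ?thesis using x hc by (simp add: H_def)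
  qed
  then have "H \<lhd> G" using sub by (simp add: normal_inv_iff)
  moreover have "b \<in> H" using b by (simp add: H_def)
  ultimately have HG: "H = carrier G" using no_real_normal_subgroup b(2) by blast
  obtain u where u: "u \<in> U" using U(2) by blast
  then have "inv u \<in> H" using HG Uc by simp
  then have "u \<otimes> inv u \<in> U" using u by (simp add: H_def)
  then show ?thesis using Uc[OF u] by simp
qed

definition proj :: "'k::{field,finite} ^ 'n::finite ^ 'n \<Rightarrow> ('k ^ 'n ^ 'n) set" where
  "proj M = SZ #>\<^bsub>SL\<^esub> M"

lemma SL_simps [simp]:
  "M \<in> carrier SL \<longleftrightarrow> det M = 1" "M \<otimes>\<^bsub>SL\<^esub> N = M ** N" "\<one>\<^bsub>SL\<^esub> = mat 1"
  by (simp_all add: SL_def)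

lemma carrier_PSL: "carrier PSL = {proj M |M. det M = 1}"
  by (auto simp: PSL_def FactGroup_def RCOSETS_def proj_def)

lemma proj_in_carrier [simp]: "det M = 1 \<Longrightarrow> proj M \<in> carrier PSL"
  by (auto simp: carrier_PSL)

lemma proj_mult: "det M = 1 \<Longrightarrow> det N = 1 \<Longrightarrow> proj M \<otimes>\<^bsub>PSL\<^esub> proj N = proj (M ** N)"
  using normal.rcos_sum[OF normal_SZ, of M N] by (simp add: PSL_def FactGroup_def proj_def)

lemma mem_proj: "M \<in> proj M" if "det M = 1"
  using that group.rcos_self[OF group_SL, of M SZ] normal_imp_subgroup[OF normal_SZ] by (simp add: proj_def)

lemma proj_eq_one_iff:
  assumes "det M = 1" shows "proj M = \<one>\<^bsub>PSL\<^esub> \<longleftrightarrow> M \<in> range mat"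
proof -
  have one: "\<one>\<^bsub>PSL\<^esub> = SZ" by (simp add: PSL_def FactGroup_def)
  have "M \<in> range mat \<longleftrightarrow> M \<in> SZ" using assms by (simp add: SZ_def)
  also have "\<dots> \<longleftrightarrow> proj M = SZ"
  proof
    assume "M \<in> SZ"
    then show "proj M = SZ" unfolding proj_def
      by (intro subgroup.rcos_const[OF normal_imp_subgroup[OF normal_SZ] group_SL])
  next
    assume "proj M = SZ"
    then show "M \<in> SZ" using mem_proj[OF assms] by simp
  qed
  finally show ?thesis by (simp add: one)
qed

lemma proj_inv:
  assumes "det M = 1" shows "inv\<^bsub>PSL\<^esub> proj M = proj (matrix_inv M)"
proof (rule group.inv_equality[OF group_PSL])
  have "proj (mat 1 :: 'a ^ 'b ^ 'b) = \<one>\<^bsub>PSL\<^esub>" by (subst proj_eq_one_iff) auto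
  then show "proj (matrix_inv M) \<otimes>\<^bsub>PSL\<^esub> proj M = \<one>\<^bsub>PSL\<^esub>"
    by (simp add: proj_mult assms matrix_inv_mult)
qed (simp_all add: assms matrix_inv_mult)

lemma proj_conj:
  assumes "det g = 1" "det M = 1"
  shows "proj g \<otimes>\<^bsub>PSL\<^esub> proj M \<otimes>\<^bsub>PSL\<^esub> inv\<^bsub>PSL\<^esub> proj g = proj (conj_by g M)"
  using assms by (simp add: proj_inv proj_mult det_mul matrix_inv_mult conj_by_def)

lemma conj_classes_PSL:
  fixes A :: "('k::{field,finite} ^ 'n::finite ^ 'n) set set"
  assumes "A \<in> conj_classes PSL"
  obtains a where "det a = 1" "A = {proj (conj_by g a) |g. det g = 1}"
proof -
  obtain x where x: "x \<in> carrier PSL" "A = orbit PSL (\<lambda>g. \<lambda>h \<in> carrier PSL. g \<otimes>\<^bsub>PSL\<^esub> h \<otimes>\<^bsub>PSL\<^esub> inv\<^bsub>PSL\<^esub> g) x"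
    using assms by (auto simp: conj_classes_def orbits_def)
  obtain a where a: "det a = 1" "x = proj a" using x(1) by (auto simp: carrier_PSL)
  have "A = {y \<otimes>\<^bsub>PSL\<^esub> x \<otimes>\<^bsub>PSL\<^esub> inv\<^bsub>PSL\<^esub> y |y. y \<in> carrier PSL}"
    using x by (simp add: orbit_def)
  also have "\<dots> = {proj (conj_by g a) |g. det g = 1}"
  proof (intro equalityI subsetI)
    fix z assume "z \<in> {y \<otimes>\<^bsub>PSL\<^esub> x \<otimes>\<^bsub>PSL\<^esub> inv\<^bsub>PSL\<^esub> y |y. y \<in> carrier PSL}"
    then obtain y where y: "y \<in> carrier PSL" "z = y \<otimes>\<^bsub>PSL\<^esub> x \<otimes>\<^bsub>PSL\<^esub> inv\<^bsub>PSL\<^esub> y" by blast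
    then obtain g where g: "det g = 1" "y = proj g" by (auto simp: carrier_PSL)
    then have "z = proj (conj_by g a)" using y(2) a proj_conj by simp
    then show "z \<in> {proj (conj_by g a) |g. det g = 1}" using g by blast
  next
    fix z assume "z \<in> {proj (conj_by g a) |g. det g = 1}"
    then obtain g where g: "det g = 1" "z = proj (conj_by g a)" by blast
    then have "z = proj g \<otimes>\<^bsub>PSL\<^esub> x \<otimes>\<^bsub>PSL\<^esub> inv\<^bsub>PSL\<^esub> proj g" using a(1) by (simp only: proj_conj a(2))
    then show "z \<in> {y \<otimes>\<^bsub>PSL\<^esub> x \<otimes>\<^bsub>PSL\<^esub> inv\<^bsub>PSL\<^esub> y |y. y \<in> carrier PSL}"
      using g by (auto intro: proj_in_carrier)
  qed
  finally show ?thesis using that a by blast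
qed

lemma num_fixed_lines_proj:
  fixes M :: "'k::{field,finite} ^ 'n::finite ^ 'n"
  assumes M: "det M = 1"
  shows "(CARD('k) - 1) * num_fixed_lines (proj M) = card (eigenvectors M)"
proof -
  have "PSL_act (proj M) W = (*v) M ` W" if "W \<in> lines" for W
    using that by (intro PSL_act_eq proj_in_carrier mem_proj M) (simp add: lines_def)
  then have "invariants lines PSL_act (proj M) = {W \<in> lines. (*v) M ` W = W}"
    by (auto simp: invariants_def)
  then show ?thesis using card_eigenvectors[OF M] by (simp add: num_fixed_lines_def)
qed

lemma card_le_3_cases:
  assumes "CARD('k::{field,finite}) \<le> 3"
  shows "(\<forall>x :: 'k. x = 0 \<or> x = 1) \<and> (1 :: 'k) + 1 = 0 \<or> (\<forall>x :: 'k. x = 0 \<or> x = 1 \<or> x = -1) \<and> (1 :: 'k) + 1 = -1"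
proof (cases "(1 :: 'k) + 1 = 0")
  case True
  have "x = 0 \<or> x = 1" for x :: 'k
  proof (rule ccontr)
    assume x: "\<not> (x = 0 \<or> x = 1)"
    then have "x + 1 \<noteq> 0" using True by (metis add_right_cancel)
    moreover have "x + 1 \<noteq> 1" "x + 1 \<noteq> x" using x by auto
    ultimately have "card {0, 1, x, x + 1} = 4" using x by auto
    moreover have "card {0, 1, x, x + 1} \<le> CARD('k)" by (intro card_mono) auto
    ultimately show False using assms by simp
  qed
  then show ?thesis using True by blast
next
  case False
  then have "(1 :: 'k) \<noteq> -1" by (metis add.left_inverse)
  moreover have "(0 :: 'k) \<noteq> 1" "(0 :: 'k) \<noteq> -1" by simp_all
  ultimately have c: "card {0, 1, -1 :: 'k} = 3" unfolding card_3_iff by blast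
  have "{0, 1, -1 :: 'k} = UNIV" using assms c by (intro card_seteq) auto
  then have all: "x = 0 \<or> x = 1 \<or> x = -1" for x :: 'k by blast
  have "(1 :: 'k) + 1 \<noteq> 1" by (metis add_cancel_right_right zero_neq_one)
  then have "(1 :: 'k) + 1 = -1" using all[of "1 + 1"] False by blast
  then show ?thesis using all by blast
qed

text \<open>
  The entries \<open>p, r, s, t\<close> are those of a non-scalar \<open>2 \<times> 2\<close> matrix, read row by row, and the
  conclusion says that its product with the matrix of rows \<open>(0, -1)\<close> and \<open>(1, 1)\<close>, an element of order
  \<open>3\<close>, is again non-scalar with a trace whose square is \<open>4\<close>.
\<close>

lemma absorbing_F2:
  fixes p r s t :: "'k::{field,finite}"
  assumes all: "\<forall>x :: 'k. x = 0 \<or> x = 1" and two: "(1 :: 'k) + 1 = 0"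
    and d: "p * t - r * s = 1" and ns: "\<not> (r = 0 \<and> s = 0 \<and> p = t)" and tr: "(p + t)\<^sup>2 = 4"
  shows "(r + (t - s))\<^sup>2 = 4 \<and> \<not> (r - p = 0 \<and> t = 0 \<and> r = t - s)"
proof -
  have f: "(4 :: 'k) = 0" using two by (metis mult_zero_left numeral_Bit0 one_add_one add.right_neutral)
  have m: "(-1 :: 'k) = 1" using two by (metis add.inverse_unique)
  show ?thesis
    using all[rule_format, of p] all[rule_format, of r] all[rule_format, of s] all[rule_format, of t] d ns tr
    by (elim disjE) (simp_all add: f m two)
qed

text \<open>
  The same for the product with the matrix of rows \<open>(0, -1)\<close> and \<open>(1, 0)\<close>, an involution modulo
  scalars.
\<close>

lemma absorbing_F3:
  fixes p r s t :: "'k::{field,finite}"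
  assumes all: "\<forall>x :: 'k. x = 0 \<or> x = 1 \<or> x = -1" and two: "(1 :: 'k) + 1 = -1"
    and d: "p * t - r * s = 1" and ns: "\<not> (r = 0 \<and> s = 0 \<and> p = t)" and tr: "(p + t)\<^sup>2 = 4"
  shows "(r - s)\<^sup>2 = 4 \<and> \<not> (p = 0 \<and> t = 0 \<and> r = - s)"
proof -
  have t2: "(2 :: 'k) = -1" using two by simp
  have "(4 :: 'k) = 2 * 2" by simp
  also have "\<dots> = 1" unfolding t2 by simp
  finally have f: "(4 :: 'k) = 1" .
  show ?thesis
    using all[rule_format, of p] all[rule_format, of r] all[rule_format, of s] all[rule_format, of t] d ns tr
    by (elim disjE) (simp_all add: f t2)
qed

text \<open>
  The elements with exactly one fixed line are the non-scalar ones with trace \<open>2\<close> or \<open>-2\<close>. In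
  \<open>PSL\<^sub>2(2) \<cong> S\<^sub>3\<close> they are the transpositions, and in \<open>PSL\<^sub>2(3) \<cong> A\<^sub>4\<close> the elements of order \<open>3\<close>. Both sets
  absorb multiplication by the normal subgroup of order \<open>3\<close> or \<open>4\<close>, respectively, from which \<open>b\<close> is
  taken.
\<close>

lemma PSL2_not_simple:
  assumes n: "CARD('n::finite) = 2" and q: "CARD('k::{field,finite}) \<le> 3"
  shows "\<not> simple_group (PSL :: ('k ^ 'n ^ 'n) set monoid)"
proof
  assume simple: "simple_group (PSL :: ('k ^ 'n ^ 'n) set monoid)"
  obtain i j :: 'n where ij: "i \<noteq> j" "UNIV = {i, j}"
    using n by (auto simp: card_2_iff)
  note simps = matrix_mult_two[OF ij] trace_two[OF ij] scalar_two[OF ij] det_two[OF ij]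
  define S where "S = {M :: 'k ^ 'n ^ 'n. det M = 1 \<and> M \<notin> range mat \<and> (trace M)\<^sup>2 = 4}"
  have "\<exists>b. det b = 1 \<and> b \<notin> range mat \<and> (\<forall>M\<in>S. M ** b \<in> S)"
    using card_le_3_cases[OF q]
  proof
    assume F: "(\<forall>x :: 'k. x = 0 \<or> x = 1) \<and> (1 :: 'k) + 1 = 0"
    define b :: "'k ^ 'n ^ 'n" where "b = (\<chi> r c. if r = i then (if c = i then 0 else - 1) else 1)"
    have be: "b $ i $ i = 0" "b $ i $ j = -1" "b $ j $ i = 1" "b $ j $ j = 1"
      using ij(1) by (simp_all add: b_def)
    have db: "det b = 1" by (simp add: simps be)
    have "M ** b \<in> S" if "M \<in> S" for M
      using that absorbing_F2[of "M $ i $ i" "M $ j $ j" "M $ i $ j" "M $ j $ i"] F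
      by (simp add: S_def det_mul db) (simp add: simps be)
    then show ?thesis using db by (intro exI[of _ b]) (simp add: simps be)
  next
    assume F: "(\<forall>x :: 'k. x = 0 \<or> x = 1 \<or> x = -1) \<and> (1 :: 'k) + 1 = -1"
    define b :: "'k ^ 'n ^ 'n" where "b = (\<chi> r c. if r = i then (if c = i then 0 else - 1) else (if c = i then 1 else 0))"
    have be: "b $ i $ i = 0" "b $ i $ j = -1" "b $ j $ i = 1" "b $ j $ j = 0"
      using ij(1) by (simp_all add: b_def)
    have db: "det b = 1" by (simp add: simps be)
    have "M ** b \<in> S" if "M \<in> S" for M
      using that absorbing_F3[of "M $ i $ i" "M $ j $ j" "M $ i $ j" "M $ j $ i"] F
      by (simp add: S_def det_mul db) (simp add: simps be)
    then show ?thesis using db by (intro exI[of _ b]) (simp add: simps be)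
  qed
  then obtain b where b: "det b = 1" "b \<notin> range mat" "\<And>M. M \<in> S \<Longrightarrow> M ** b \<in> S" by blast
  have "\<one>\<^bsub>PSL\<^esub> \<in> proj ` S"
  proof (rule simple_group_absorbing_set[OF simple])
    show "finite (carrier (PSL :: ('k ^ 'n ^ 'n) set monoid))" by simp
    show "proj ` S \<subseteq> carrier PSL" by (auto simp: S_def)
    define M0 :: "'k ^ 'n ^ 'n" where "M0 = (\<chi> r c. if r = j \<and> c = i then 0 else 1)"
    have "M0 $ i $ i = 1" "M0 $ i $ j = 1" "M0 $ j $ i = 0" "M0 $ j $ j = 1"
      using ij(1) by (auto simp: M0_def)
    then have "M0 \<in> S" by (simp add: S_def simps)
    then show "proj ` S \<noteq> {}" by blast
    show "g \<otimes>\<^bsub>PSL\<^esub> u \<otimes>\<^bsub>PSL\<^esub> inv\<^bsub>PSL\<^esub> g \<in> proj ` S" if "g \<in> carrier PSL" "u \<in> proj ` S" for g u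
    proof -
      obtain G M where G: "det G = 1" "g = proj G" and M: "M \<in> S" "u = proj M"
        using \<open>g \<in> carrier PSL\<close> \<open>u \<in> proj ` S\<close> by (auto simp: carrier_PSL)
      have "conj_by G M \<in> S"
        using M(1) by (simp add: S_def det_conj_by G conj_by_scalar_iff trace_conj_by)
      moreover have "g \<otimes>\<^bsub>PSL\<^esub> u \<otimes>\<^bsub>PSL\<^esub> inv\<^bsub>PSL\<^esub> g = proj (conj_by G M)"
        using M(1) G(1) by (simp add: G(2) M(2) proj_conj S_def)
      ultimately show ?thesis by simp
    qed
    show "proj b \<in> carrier PSL" using b by simp
    show "proj b \<noteq> \<one>\<^bsub>PSL\<^esub>" using b proj_eq_one_iff by blast
    show "u \<otimes>\<^bsub>PSL\<^esub> proj b \<in> proj ` S" if "u \<in> proj ` S" for u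
    proof -
      obtain M where M: "M \<in> S" "u = proj M" using \<open>u \<in> proj ` S\<close> by blast
      then have "u \<otimes>\<^bsub>PSL\<^esub> proj b = proj (M ** b)" using b by (simp add: proj_mult S_def)
      then show ?thesis using b(3)[OF M(1)] by simp
    qed
  qed
  then obtain M where M: "M \<in> S" "proj M = \<one>\<^bsub>PSL\<^esub>" by (metis imageE)
  then show False using proj_eq_one_iff[of M] by (simp add: S_def)
qed

lemma fixed_lines_not_constant:
  fixes a b :: "'k::{field,finite} ^ 'n::finite ^ 'n"
  assumes simple: "simple_group (PSL :: ('k ^ 'n ^ 'n) set monoid)"
    and a: "det a = 1" "a \<notin> range mat" and b: "det b = 1" "b \<notin> range mat"
  obtains g where "det g = 1" "card (eigenvectors (a ** conj_by g b)) \<noteq> card (eigenvectors (a ** b))"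
proof -
  have contra: False
    if x: "det x = 1" "x \<notin> range mat" and y: "det y = 1" "y \<notin> range mat"
      and one: "card (eigenvectors x) = CARD('k) - 1"
      and m: "\<And>g. det g = 1 \<Longrightarrow> card (eigenvectors (x ** conj_by g y)) = CARD('k) - 1"
    for x y :: "'k ^ 'n ^ 'n"
  proof (cases "CARD('n) = 2")
    case True
    then have "CARD('k) \<le> 3" by (rule field_size_of_constant_one_line[OF _ x y one m])
    then show False using PSL2_not_simple[OF True] simple by blast
  next
    case False
    then have "CARD('n) \<ge> 3" using nonscalar_dimension[OF x(2)] by simp
    then show False using two_fixed_lines[OF _ x y(2) one] m by blast
  qed
  have False if const: "\<And>g. det g = 1 \<Longrightarrow> card (eigenvectors (a ** conj_by g b)) = card (eigenvectors (a ** b))"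
  proof -
    have q: "card (eigenvectors (a ** b)) = CARD('k) - 1"
      and "card (eigenvectors a) = CARD('k) - 1 \<or> card (eigenvectors b) = CARD('k) - 1"
      using constant_fixed_lines_eq_1[OF a b const] by blast+
    then show False
    proof (elim disjE)
      assume "card (eigenvectors a) = CARD('k) - 1"
      then show False using contra[OF a b] const q by simp
    next
      assume one: "card (eigenvectors b) = CARD('k) - 1"
      have "card (eigenvectors (b ** conj_by g a)) = CARD('k) - 1" if g: "det g = 1" for g
        using card_eigenvectors_swap[OF b(1) g, of a] const[OF matrix_inv_mult(3)[OF g]] q by simp
      then show False using contra[OF b a one] by blast
    qed
  qed
  then show ?thesis using that by blast
qed

theorem theorem1p5:
  fixes A B :: "('k::{field,finite} ^ 'n::finite ^ 'n) set set"
  assumes "simple_group (PSL :: ('k ^ 'n ^ 'n) set monoid)"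
    and "A \<in> conj_classes PSL" and "A \<noteq> {\<one>\<^bsub>PSL\<^esub>}"
    and "B \<in> conj_classes PSL" and "B \<noteq> {\<one>\<^bsub>PSL\<^esub>}"
  shows "\<not> num_fixed_lines constant_on (A <#>\<^bsub>PSL\<^esub> B)
    \<and> A <#>\<^bsub>PSL\<^esub> B \<notin> conj_classes PSL"
proof -
  obtain a where a: "det a = 1" "A = {proj (conj_by g a) |g. det g = 1}"
    using conj_classes_PSL[OF assms(2)] .
  obtain b where b: "det b = 1" "B = {proj (conj_by g b) |g. det g = 1}"
    using conj_classes_PSL[OF assms(4)] .
  have nonscalar: "x \<notin> range mat"
    if x: "det x = 1" "X = {proj (conj_by g x) |g. det g = 1}" "X \<noteq> {\<one>\<^bsub>PSL\<^esub>}"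
    for x :: "'k ^ 'n ^ 'n" and X
  proof
    assume "x \<in> range mat"
    then have "proj (conj_by g x) = \<one>\<^bsub>PSL\<^esub>" if "det g = 1" for g
      using that proj_eq_one_iff[of "conj_by g x"] conj_by_scalar_iff[OF that, of x] det_conj_by[OF that, of x] x(1)
      by simp
    moreover have "det (mat 1 :: 'k ^ 'n ^ 'n) = 1" by simp
    ultimately have "X = {\<one>\<^bsub>PSL\<^esub>}" unfolding x(2) by blast
    then show False using x(3) by simp
  qed
  have prod: "proj (a ** conj_by g b) \<in> A <#>\<^bsub>PSL\<^esub> B" if g: "det g = 1" for g
  proof -
    have "proj (conj_by (mat 1) a) \<in> A" unfolding a(2) using det_I by blast
    moreover have "proj (conj_by g b) \<in> B" unfolding b(2) using g by blast
    moreover have "proj a \<otimes>\<^bsub>PSL\<^esub> proj (conj_by g b) = proj (a ** conj_by g b)"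
      using a b g by (simp add: proj_mult det_conj_by)
    ultimately show ?thesis unfolding set_mult_def by force
  qed
  have not_const: "\<not> num_fixed_lines constant_on (A <#>\<^bsub>PSL\<^esub> B)"
  proof
    assume "num_fixed_lines constant_on (A <#>\<^bsub>PSL\<^esub> B)"
    then obtain y where y: "\<And>x. x \<in> A <#>\<^bsub>PSL\<^esub> B \<Longrightarrow> num_fixed_lines x = y"
      unfolding constant_on_def by blast
    have E: "card (eigenvectors (a ** conj_by g b)) = (CARD('k) - 1) * y" if g: "det g = 1" for g
      using num_fixed_lines_proj[of "a ** conj_by g b"] y[OF prod[OF g]] a b g
      by (simp add: det_mul det_conj_by)
    obtain g where "det g = 1" "card (eigenvectors (a ** conj_by g b)) \<noteq> card (eigenvectors (a ** b))"
      using fixed_lines_not_constant[OF assms(1) a(1) nonscalar[OF a assms(3)] b(1) nonscalar[OF b assms(5)]] .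
    then show False using E[of g] E[of "mat 1"] by simp
  qed
  moreover have "A <#>\<^bsub>PSL\<^esub> B \<notin> conj_classes PSL"
  proof
    assume "A <#>\<^bsub>PSL\<^esub> B \<in> conj_classes PSL"
    then obtain c where c: "det c = 1" "A <#>\<^bsub>PSL\<^esub> B = {proj (conj_by g c) |g. det g = 1}"
      by (rule conj_classes_PSL)
    have "num_fixed_lines (proj (conj_by g c)) = num_fixed_lines (proj c)" if g: "det g = 1" for g
    proof -
      have "(CARD('k) - 1) * num_fixed_lines (proj (conj_by g c)) = (CARD('k) - 1) * num_fixed_lines (proj c)"
        using c(1) by (simp only: num_fixed_lines_proj det_conj_by[OF g] card_eigenvectors_conj_by[OF g])
      then show ?thesis using CARD_gt_1[where 'k = 'k] by simp
    qed
    then have "num_fixed_lines constant_on (A <#>\<^bsub>PSL\<^esub> B)"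
      unfolding c(2) constant_on_def by blast
    then show False using not_const by simp
  qed
  ultimately show ?thesis by blast
qed

end
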